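(* Let $X \subset \mathbb{R}^n$ be an open set that is star-shaped at the origin, and let $\phi : X \to \mathbb{R}^m$ be a nonsingular differentially algebraic (DA) function on $X$. Then $\phi$ has an R-FISCIDS representation, a P-FISCIDS representation, and a Q-FISCIDS representation.
   Context: A set $X \subset \mathbb{R}^n$ is star-shaped at $\xi_0$ if $\xi_0 + s(\xi - \xi_0) \in X$ for all $\xi \in X$ and $s \in [0,1]$. DA functions. Let $X \subset \mathbb{R}^n$ be open. A (real-)analytic function $\phi : X \to \mathbb{R}$ is called a DA function if for each $i = 1,\ldots,n$ there exist a nonnegative integer $\rho_i$ and a nonzero polynomial $p_i(\xi, Y_0, \ldots, Y_{\rho_i})$ with real coefficients (in the variables $\xi = (\xi_1,\ldots,\xi_n)$ and $Y_0,\ldots,Y_{\rho_i}$) such that $$p_i\left(\xi, \phi(\xi), \frac{\partial \phi(\xi)}{\partial \xi_i}, \ldots, \frac{\partial^{\rho_i}\phi(\xi)}{\partial \xi_i^{\rho_i}}\right) = 0 \quad \text{for all } \xi \in X.$$ If moreover (for these $p_i$, $\rho_i$) $$\frac{\partial p_i}{\partial Y_{\rho_i}}\left(\xi, \phi(\xi), \frac{\partial \phi(\xi)}{\partial \xi_i}, \ldots, \frac{\partial^{\rho_i}\phi(\xi)}{\partial \xi_i^{\rho_i}}\right) \neq 0 \quad \text{for all } \xi \in X \text{ and each } i,$$ then $\phi$ is called nonsingular on $X$. A vector-valued function is called a nonsingular DA function if each of its components is DA and nonsingular. FISCIDS representations. Let $\phi : X \to \mathbb{R}^m$ with $X \subset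 \mathbb{R}^n$ open. Consider an $N$-dimensional system with fixed initial state $z_0 \in \mathbb{R}^N$ (independent of $\xi$) and constant input $\xi \in X$: $$\dot z(\tau) = F(z(\tau))\,\xi, \quad z(0) = z_0, \qquad y(\tau) = h(z(\tau)),$$ where $F : Z \to \mathbb{R}^{N\times n}$ and $h : Z \to \mathbb{R}^m$ are defined on an open set $Z \subset \mathbb{R}^N$ containing $z_0$. Let $z(\tau;\xi)$ and $y(\tau;\xi)$ denote its state trajectory (in $Z$) and output. If for every $\xi \in X$ the trajectory $z(\tau;\xi)$ is defined for all $\tau \in [0,1]$ and $y(1;\xi) = \phi(\xi)$, the system, also specified by the tuple $(F(z),h(z),z_0)$, is called a FISCIDS (fixed-initial-state constant-input dynamical system) representation of $\phi$. It is an R-FISCIDS (rational) representation if the entries of $F$ and $h$ are rational functions of $z$ (quotients of polynomials whose denominators do not vanish on $Z$); a P-FISCIDS (polynomial) representation if the entries of $F$ and $h$ are polynomials; and a Q-FISCIDS (quadratic) representation if the entries of $F$ are polynomials of degree at most two and the entries of $h$ are affine functions. *)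

theory Defs
  imports "HOL-Analysis.Analysis" "HOL-Library.Poly_Mapping"
begin

section \<open>Multivariate real polynomials\<close>

text \<open>A monomial is a finitely supported exponent function, and a polynomial is a finitely
  supported family of coefficients indexed by monomials.\<close>

type_synonym 'v mpoly = "('v \<Rightarrow>\<^sub>0 nat) \<Rightarrow>\<^sub>0 real"

definition mpoly_vars :: "'v mpoly \<Rightarrow> 'v set" where
  "mpoly_vars p = (\<Union>m \<in> Poly_Mapping.keys p. Poly_Mapping.keys m)"

definition mpoly_eval :: "'v mpoly \<Rightarrow> ('v \<Rightarrow> real) \<Rightarrow> real" where
  "mpoly_eval p v = (\<Sum>m \<in> Poly_Mapping.keys p. Poly_Mapping.lookup p m *
     (\<Prod>x \<in> Poly_Mapping.keys m. v x ^ Poly_Mapping.lookup m x))"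

text \<open>A term not containing the variable \<open>x\<close> contributes \<open>0\<close> to the formal partial derivative
  because its new coefficient is \<open>0\<close>, so truncation in the exponent does no harm.\<close>

definition mpoly_pderiv :: "'v \<Rightarrow> 'v mpoly \<Rightarrow> 'v mpoly" where
  "mpoly_pderiv x p = (\<Sum>m \<in> Poly_Mapping.keys p.
     Poly_Mapping.single (m - Poly_Mapping.single x 1)
       (Poly_Mapping.lookup p m * real (Poly_Mapping.lookup m x)))"

definition mpoly_degree_le :: "nat \<Rightarrow> 'v mpoly \<Rightarrow> bool" where
  "mpoly_degree_le d p \<longleftrightarrow> (\<forall>m \<in> Poly_Mapping.keys p.
     (\<Sum>x \<in> Poly_Mapping.keys m. Poly_Mapping.lookup m x) \<le> d)"

section \<open>Nonsingular differentially algebraic functions\<close>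

definition star_shaped_at :: "'a::real_vector set \<Rightarrow> 'a \<Rightarrow> bool" where
  "star_shaped_at X a \<longleftrightarrow> (\<forall>x \<in> X. \<forall>s \<in> {0..1}. a + s *\<^sub>R (x - a) \<in> X)"

text \<open>Local expansion into a power series over all multi-indices; \<open>has_sum\<close> is unconditional
  (hence absolute) convergence, as usual for power series in several variables.\<close>

definition real_analytic_on :: "(real^'n \<Rightarrow> real) \<Rightarrow> (real^'n) set \<Rightarrow> bool" where
  "real_analytic_on f X \<longleftrightarrow> (\<forall>x \<in> X. \<exists>r > 0. \<exists>c :: ('n \<Rightarrow> nat) \<Rightarrow> real. \<forall>y \<in> X \<inter> ball x r.
     ((\<lambda>\<alpha>. c \<alpha> * (\<Prod>i\<in>UNIV. (y $ i - x $ i) ^ \<alpha> i)) has_sum f y) UNIV)"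

definition partial_deriv :: "'n \<Rightarrow> (real^'n \<Rightarrow> real) \<Rightarrow> real^'n \<Rightarrow> real" where
  "partial_deriv i f x = deriv (\<lambda>t. f (x + t *\<^sub>R axis i 1)) 0"

text \<open>Variables of the differential polynomials: \<open>Inl j\<close> is the coordinate \<open>\<xi>\<^sub>j\<close> and \<open>Inr k\<close> is
  \<open>Y\<^sub>k\<close>, which stands for the \<open>k\<close>-th partial derivative in direction \<open>i\<close>.\<close>

definition jet :: "(real^'n \<Rightarrow> real) \<Rightarrow> 'n \<Rightarrow> real^'n \<Rightarrow> 'n + nat \<Rightarrow> real" where
  "jet f i x = case_sum (\<lambda>j. x $ j) (\<lambda>k. (partial_deriv i ^^ k) f x)"

definition DA_equation ::
  "(real^'n) set \<Rightarrow> (real^'n \<Rightarrow> real) \<Rightarrow> 'n \<Rightarrow> nat \<Rightarrow> ('n + nat) mpoly \<Rightarrow> bool" where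
  "DA_equation X f i \<rho> p \<longleftrightarrow>
     p \<noteq> 0 \<and> mpoly_vars p \<subseteq> range Inl \<union> Inr ` {..\<rho>} \<and>
     (\<forall>x \<in> X. mpoly_eval p (jet f i x) = 0)"

definition DA_function :: "(real^'n) set \<Rightarrow> (real^'n \<Rightarrow> real) \<Rightarrow> bool" where
  "DA_function X f \<longleftrightarrow> real_analytic_on f X \<and> (\<forall>i. \<exists>\<rho> p. DA_equation X f i \<rho> p)"

definition nonsingular_DA_function :: "(real^'n) set \<Rightarrow> (real^'n \<Rightarrow> real) \<Rightarrow> bool" where
  "nonsingular_DA_function X f \<longleftrightarrow> DA_function X f \<and>
     (\<forall>i. \<exists>\<rho> p. DA_equation X f i \<rho> p \<and>
        (\<forall>x \<in> X. mpoly_eval (mpoly_pderiv (Inr \<rho>) p) (jet f i x) \<noteq> 0))"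

definition nonsingular_DA_map :: "(real^'n) set \<Rightarrow> (real^'n \<Rightarrow> real^'m) \<Rightarrow> bool" where
  "nonsingular_DA_map X \<phi> \<longleftrightarrow> (\<forall>k. nonsingular_DA_function X (\<lambda>x. \<phi> x $ k))"

section \<open>FISCIDS representations\<close>

text \<open>The state dimension \<open>N\<close> is existentially quantified, so the state space is the library's
  \<open>Euclidean_space N\<close>: real sequences vanishing from index \<open>N\<close> on.\<close>

definition is_trajectory ::
  "nat \<Rightarrow> (nat \<Rightarrow> real) set \<Rightarrow> ((nat \<Rightarrow> real) \<Rightarrow> nat \<Rightarrow> 'n \<Rightarrow> real) \<Rightarrow> (nat \<Rightarrow> real) \<Rightarrow> real^'n
    \<Rightarrow> (real \<Rightarrow> nat \<Rightarrow> real) \<Rightarrow> bool" where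
  "is_trajectory N Z F z0 \<xi> z \<longleftrightarrow>
     z 0 = z0 \<and>
     (\<forall>\<tau> \<in> {0..1}. z \<tau> \<in> Z \<and>
        (\<forall>i < N. ((\<lambda>t. z t i) has_real_derivative (\<Sum>j\<in>UNIV. F (z \<tau>) i j * \<xi> $ j))
           (at \<tau> within {0..1})))"

text \<open>For \<open>F\<close> that need not be locally Lipschitz, trajectories need not be unique; then all of
  them are required to yield the correct output.\<close>

definition FISCIDS ::
  "(real^'n) set \<Rightarrow> (real^'n \<Rightarrow> real^'m) \<Rightarrow> nat \<Rightarrow> (nat \<Rightarrow> real) set
    \<Rightarrow> ((nat \<Rightarrow> real) \<Rightarrow> nat \<Rightarrow> 'n \<Rightarrow> real) \<Rightarrow> ((nat \<Rightarrow> real) \<Rightarrow> real^'m) \<Rightarrow> (nat \<Rightarrow> real) \<Rightarrow> bool" where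
  "FISCIDS X \<phi> N Z F h z0 \<longleftrightarrow>
     openin (Euclidean_space N) Z \<and> z0 \<in> Z \<and>
     (\<forall>\<xi> \<in> X. (\<exists>z. is_trajectory N Z F z0 \<xi> z) \<and>
               (\<forall>z. is_trajectory N Z F z0 \<xi> z \<longrightarrow> h (z 1) = \<phi> \<xi>))"

definition rational_on :: "nat \<Rightarrow> (nat \<Rightarrow> real) set \<Rightarrow> ((nat \<Rightarrow> real) \<Rightarrow> real) \<Rightarrow> bool" where
  "rational_on N Z g \<longleftrightarrow> (\<exists>p q. mpoly_vars p \<subseteq> {..<N} \<and> mpoly_vars q \<subseteq> {..<N} \<and>
     (\<forall>z \<in> Z. mpoly_eval q z \<noteq> 0 \<and> g z = mpoly_eval p z / mpoly_eval q z))"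

definition polynomial_on :: "nat \<Rightarrow> (nat \<Rightarrow> real) set \<Rightarrow> ((nat \<Rightarrow> real) \<Rightarrow> real) \<Rightarrow> bool" where
  "polynomial_on N Z g \<longleftrightarrow> (\<exists>p. mpoly_vars p \<subseteq> {..<N} \<and> (\<forall>z \<in> Z. g z = mpoly_eval p z))"

definition quadratic_on :: "nat \<Rightarrow> (nat \<Rightarrow> real) set \<Rightarrow> ((nat \<Rightarrow> real) \<Rightarrow> real) \<Rightarrow> bool" where
  "quadratic_on N Z g \<longleftrightarrow> (\<exists>p. mpoly_vars p \<subseteq> {..<N} \<and> mpoly_degree_le 2 p \<and>
     (\<forall>z \<in> Z. g z = mpoly_eval p z))"

definition affine_on :: "nat \<Rightarrow> (nat \<Rightarrow> real) set \<Rightarrow> ((nat \<Rightarrow> real) \<Rightarrow> real) \<Rightarrow> bool" where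
  "affine_on N Z g \<longleftrightarrow> (\<exists>b a. \<forall>z \<in> Z. g z = b + (\<Sum>i<N. a i * z i))"

definition R_FISCIDS ::
  "(real^'n) set \<Rightarrow> (real^'n \<Rightarrow> real^'m) \<Rightarrow> nat \<Rightarrow> (nat \<Rightarrow> real) set
    \<Rightarrow> ((nat \<Rightarrow> real) \<Rightarrow> nat \<Rightarrow> 'n \<Rightarrow> real) \<Rightarrow> ((nat \<Rightarrow> real) \<Rightarrow> real^'m) \<Rightarrow> (nat \<Rightarrow> real) \<Rightarrow> bool" where
  "R_FISCIDS X \<phi> N Z F h z0 \<longleftrightarrow> FISCIDS X \<phi> N Z F h z0 \<and>
     (\<forall>i < N. \<forall>j. rational_on N Z (\<lambda>z. F z i j)) \<and> (\<forall>k. rational_on N Z (\<lambda>z. h z $ k))"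

definition P_FISCIDS ::
  "(real^'n) set \<Rightarrow> (real^'n \<Rightarrow> real^'m) \<Rightarrow> nat \<Rightarrow> (nat \<Rightarrow> real) set
    \<Rightarrow> ((nat \<Rightarrow> real) \<Rightarrow> nat \<Rightarrow> 'n \<Rightarrow> real) \<Rightarrow> ((nat \<Rightarrow> real) \<Rightarrow> real^'m) \<Rightarrow> (nat \<Rightarrow> real) \<Rightarrow> bool" where
  "P_FISCIDS X \<phi> N Z F h z0 \<longleftrightarrow> FISCIDS X \<phi> N Z F h z0 \<and>
     (\<forall>i < N. \<forall>j. polynomial_on N Z (\<lambda>z. F z i j)) \<and> (\<forall>k. polynomial_on N Z (\<lambda>z. h z $ k))"

definition Q_FISCIDS ::
  "(real^'n) set \<Rightarrow> (real^'n \<Rightarrow> real^'m) \<Rightarrow> nat \<Rightarrow> (nat \<Rightarrow> real) set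
    \<Rightarrow> ((nat \<Rightarrow> real) \<Rightarrow> nat \<Rightarrow> 'n \<Rightarrow> real) \<Rightarrow> ((nat \<Rightarrow> real) \<Rightarrow> real^'m) \<Rightarrow> (nat \<Rightarrow> real) \<Rightarrow> bool" where
  "Q_FISCIDS X \<phi> N Z F h z0 \<longleftrightarrow> FISCIDS X \<phi> N Z F h z0 \<and>
     (\<forall>i < N. \<forall>j. quadratic_on N Z (\<lambda>z. F z i j)) \<and> (\<forall>k. affine_on N Z (\<lambda>z. h z $ k))"

end

theory Submission
  imports Defs
begin

text \<open>A quadratic system is polynomial and a polynomial one is rational, so only the quadratic
  representation has to be built. If a finite set \<open>B\<close> of functions on \<open>X\<close> contains the components of
  \<open>\<phi>\<close> and the partial derivatives of its members are quadratic forms in the members of \<open>B\<close>, then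
  \<open>z(\<tau>) = (b(\<tau>\<xi>))\<^sub>b\<close> is the trajectory of a quadratic system, by the chain rule along the segment
  from \<open>0\<close> to \<open>\<xi>\<close>; it is the only one because the difference of two trajectories solves a linear
  differential equation.

  Such a \<open>B\<close> is obtained from a finite set \<open>G\<close> whose partial derivatives are polynomials in \<open>G\<close>:
  take all products of \<open>d\<close> elements of \<open>G \<union> {1}\<close>, with \<open>d\<close> bounding the degrees of these polynomials.
  Finally \<open>G\<close> consists of the coordinates, the mixed derivatives of the components of \<open>\<phi>\<close> of order at
  most \<open>\<rho>\<^sub>i\<close> in \<open>\<xi>\<^sub>i\<close>, and the reciprocals of the separants \<open>\<partial>p\<^sub>i/\<partial>Y\<close>: differentiating the \<open>i\<close>-th
  equation once expresses the derivative of order \<open>\<rho>\<^sub>i + 1\<close> through lower ones, and applying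
  derivatives in the other directions to this relation keeps the orders within the box.\<close>

section \<open>Differentiation of power series in several variables\<close>

lemma summable_on_comparison_real:
  fixes f M :: "'a \<Rightarrow> real"
  assumes "M summable_on A" "\<And>x. x \<in> A \<Longrightarrow> \<bar>f x\<bar> \<le> M x"
  shows "f summable_on A"
  by (subst summable_on_iff_abs_summable_on_real, rule Infinite_Sum.abs_summable_on_comparison_test'[OF assms(1)])
    (use assms(2) in auto)

text \<open>Termwise differentiation of an unconditional sum: the index set is enumerated by the
  naturals, and the common majorant \<open>M\<close> makes the series of partial derivatives
  converge uniformly on \<open>S\<close> by the Weierstrass test.\<close>

lemma has_derivative_has_sum:
  fixes f :: "'i::countable \<Rightarrow> real^'n \<Rightarrow> real" and D :: "'i \<Rightarrow> 'n \<Rightarrow> real^'n \<Rightarrow> real"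
  assumes inf: "infinite (UNIV :: 'i set)"
    and S: "convex S" "open S" and x: "x \<in> S"
    and f: "\<And>i x. x \<in> S \<Longrightarrow> (f i has_derivative (\<lambda>h. \<Sum>j\<in>UNIV. h $ j * D i j x)) (at x)"
    and le: "\<And>i j x. x \<in> S \<Longrightarrow> \<bar>D i j x\<bar> \<le> M i"
    and M: "M summable_on UNIV"
    and g: "\<And>x. x \<in> S \<Longrightarrow> ((\<lambda>i. f i x) has_sum g x) UNIV"
  shows "(g has_derivative (\<lambda>h. \<Sum>j\<in>UNIV. h $ j * (\<Sum>\<^sub>\<infinity>i. D i j x))) (at x)"
proof -
  obtain e' :: "'i \<Rightarrow> nat" where "bij_betw e' UNIV UNIV"
    using countableE_infinite[OF _ inf] by auto
  then obtain e :: "nat \<Rightarrow> 'i" where e: "bij_betw e UNIV UNIV"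
    using bij_betw_inv by blast
  have D_summable: "(\<lambda>i. D i j y) summable_on UNIV" if "y \<in> S" for j y
    by (rule summable_on_comparison_real[OF M]) (use le[OF that] in auto)
  have sums: "(\<lambda>n. F (e n)) sums l" if "(F has_sum l) UNIV" for F :: "'i \<Rightarrow> real" and l
    using that has_sum_reindex_bij_betw[OF e, of F l] has_sum_imp_sums by blast
  have Msum: "summable (\<lambda>n. M (e n))"
    using sums[of M "infsum M UNIV"] M by (auto simp: sums_iff)
  have lim: "uniform_limit S (\<lambda>n y. \<Sum>i<n. D (e i) j y) (\<lambda>y. \<Sum>\<^sub>\<infinity>i. D i j y) sequentially" for j
  proof -
    have "uniform_limit S (\<lambda>n y. \<Sum>i<n. D (e i) j y) (\<lambda>y. suminf (\<lambda>i. D (e i) j y)) sequentially"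
      using le Msum by (intro Weierstrass_m_test[where M = "\<lambda>n. M (e n)"]) auto
    moreover have "suminf (\<lambda>i. D (e i) j y) = (\<Sum>\<^sub>\<infinity>i. D i j y)" if "y \<in> S" for y
      using sums[of "\<lambda>i. D i j y"] D_summable[OF that] by (auto simp: sums_iff)
    ultimately show ?thesis
      by (subst uniform_limit_cong') auto
  qed
  have "\<exists>g'. \<forall>y\<in>S. (\<lambda>n. f (e n) y) sums g' y \<and>
      (g' has_derivative (\<lambda>h. \<Sum>j\<in>UNIV. h $ j * (\<Sum>\<^sub>\<infinity>i. D i j y))) (at y within S)"
  proof (rule has_derivative_series[OF S(1)])
    show "(f (e n) has_derivative (\<lambda>h. \<Sum>j\<in>UNIV. h $ j * D (e n) j y)) (at y within S)"
      if "y \<in> S" for n y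
      using f[OF that] has_derivative_at_withinI by blast
    show "\<forall>\<^sub>F n in sequentially. \<forall>y\<in>S. \<forall>h. norm ((\<Sum>i<n. \<Sum>j\<in>UNIV. h $ j * D (e i) j y)
        - (\<Sum>j\<in>UNIV. h $ j * (\<Sum>\<^sub>\<infinity>i. D i j y))) \<le> \<epsilon> * norm h" if "\<epsilon> > 0" for \<epsilon>
    proof -
      \<comment> \<open>Each coordinate of \<open>h\<close> is at most \<open>norm h\<close>, so an
        error \<open>\<delta>\<close> in each of the \<open>CARD('n)\<close> partial derivatives
        adds up to at most \<open>\<epsilon> * norm h\<close>.\<close>
      define \<delta> where "\<delta> = \<epsilon> / real CARD('n)"
      have "\<delta> > 0" using that by (simp add: \<delta>_def)
      then have "\<forall>\<^sub>F n in sequentially. \<forall>j. \<forall>y\<in>S. \<bar>(\<Sum>i<n. D (e i) j y) - (\<Sum>\<^sub>\<infinity>i. D i j y)\<bar> < \<delta>"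
        using uniform_limitD[OF lim] by (auto simp: dist_real_def intro!: eventually_all_finite)
      then show ?thesis
      proof eventually_elim
        case (elim n)
        show ?case
        proof (intro ballI allI)
          fix y h assume y: "y \<in> S"
          have "(\<Sum>i<n. \<Sum>j\<in>UNIV. h $ j * D (e i) j y) = (\<Sum>j\<in>UNIV. h $ j * (\<Sum>i<n. D (e i) j y))"
            by (subst sum.swap) (simp add: sum_distrib_left)
          then have "norm ((\<Sum>i<n. \<Sum>j\<in>UNIV. h $ j * D (e i) j y) - (\<Sum>j\<in>UNIV. h $ j * (\<Sum>\<^sub>\<infinity>i. D i j y)))
              = \<bar>\<Sum>j\<in>UNIV. h $ j * ((\<Sum>i<n. D (e i) j y) - (\<Sum>\<^sub>\<infinity>i. D i j y))\<bar>"
            by (simp add: sum_subtractf right_diff_distrib)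
          also have "\<dots> \<le> (\<Sum>j\<in>(UNIV::'n set). norm h * \<delta>)"
            using elim y component_le_norm_cart[of h]
            by (intro order_trans[OF sum_abs] sum_mono) (auto simp: abs_mult less_imp_le intro!: mult_mono)
          also have "\<dots> = \<epsilon> * norm h" by (simp add: \<delta>_def)
          finally show "norm ((\<Sum>i<n. \<Sum>j\<in>UNIV. h $ j * D (e i) j y)
            - (\<Sum>j\<in>UNIV. h $ j * (\<Sum>\<^sub>\<infinity>i. D i j y))) \<le> \<epsilon> * norm h" .
        qed
      qed
    qed
    show "x \<in> S" by fact
    show "(\<lambda>n. f (e n) x) sums g x"
      using sums[OF g[OF x]] .
  qed
  then obtain g' where g': "\<And>y. y \<in> S \<Longrightarrow> (\<lambda>n. f (e n) y) sums g' y"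
      "\<And>y. y \<in> S \<Longrightarrow> (g' has_derivative (\<lambda>h. \<Sum>j\<in>UNIV. h $ j * (\<Sum>\<^sub>\<infinity>i. D i j y))) (at y within S)"
    by blast
  \<comment> \<open>\<open>g'\<close> is only known as a limit of the enumerated series; uniqueness
    of sums identifies it with \<open>g\<close> on \<open>S\<close>.\<close>
  have "g' y = g y" if "y \<in> S" for y
    using sums_unique2[OF g'(1)[OF that] sums[OF g[OF that]]] .
  have "(g' has_derivative (\<lambda>h. \<Sum>j\<in>UNIV. h $ j * (\<Sum>\<^sub>\<infinity>i. D i j x))) (at x)"
    using g'(2)[OF x] at_within_open[OF x S(2)] by simp
  then show ?thesis
    by (rule has_derivative_transform_within_open[OF _ S(2) x]) fact
qed

section \<open>Power series indexed by multi-indices\<close>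

definition monom_val :: "('n \<Rightarrow> nat) \<Rightarrow> real^'n \<Rightarrow> real" where
  "monom_val \<alpha> u = (\<Prod>i\<in>UNIV. (u $ i) ^ \<alpha> i)"

text \<open>The \<open>i\<close>-th partial derivative of \<open>monom_val \<alpha>\<close>. For
  \<open>\<alpha> i = 0\<close> the truncated exponent is harmless, because the factor in front
  vanishes.\<close>

definition monom_deriv :: "('n \<Rightarrow> nat) \<Rightarrow> 'n \<Rightarrow> real^'n \<Rightarrow> real" where
  "monom_deriv \<alpha> i u = real (\<alpha> i) * (u $ i) ^ (\<alpha> i - 1) * (\<Prod>j\<in>UNIV - {i}. (u $ j) ^ \<alpha> j)"

text \<open>The coefficient family of the \<open>i\<close>-th partial derivative of the power series
  with coefficients \<open>c\<close>.\<close>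

definition shift_coeff :: "'n \<Rightarrow> (('n \<Rightarrow> nat) \<Rightarrow> real) \<Rightarrow> ('n \<Rightarrow> nat) \<Rightarrow> real" where
  "shift_coeff i c \<alpha> = real (\<alpha> i + 1) * c (\<alpha>(i := \<alpha> i + 1))"

lemma shift_coeff_commute: "shift_coeff i (shift_coeff j c) = shift_coeff j (shift_coeff i c)"
  by (cases "i = j") (auto simp: shift_coeff_def fun_upd_twist)

lemma has_derivative_monom_val:
  "(monom_val \<alpha> has_derivative (\<lambda>h. \<Sum>i\<in>UNIV. h $ i * monom_deriv \<alpha> i u)) (at u)"
proof -
  have "((\<lambda>u. u $ i ^ \<alpha> i) has_derivative (\<lambda>h. real (\<alpha> i) * h $ i * u $ i ^ (\<alpha> i - 1))) (at u)" for i
    using has_derivative_power[OF bounded_linear_imp_has_derivative[OF bounded_linear_vec_nth]] .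
  then have "((\<lambda>u. \<Prod>i\<in>UNIV. u $ i ^ \<alpha> i) has_derivative
      (\<lambda>h. \<Sum>i\<in>UNIV. real (\<alpha> i) * h $ i * u $ i ^ (\<alpha> i - 1) * (\<Prod>j\<in>UNIV - {i}. u $ j ^ \<alpha> j))) (at u)"
    by (intro has_derivative_prod) auto
  then show ?thesis
    by (simp add: monom_val_def[abs_def] monom_deriv_def mult_ac)
qed

text \<open>The remaining exponents sum to the total degree minus one and the leading factor is at
  most the total degree. The bound involves neither \<open>i\<close> nor the position of
  \<open>u\<close> in the ball, as a majorant must.\<close>

lemma monom_deriv_bound:
  fixes u :: "real^'n"
  assumes t: "norm u \<le> t"
  shows "\<bar>monom_deriv \<alpha> i u\<bar> \<le> real (\<Sum>j\<in>UNIV. \<alpha> j) * t ^ ((\<Sum>j\<in>UNIV. \<alpha> j) - 1)"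
proof (cases "\<alpha> i = 0")
  case True
  then show ?thesis
    using order_trans[OF norm_ge_zero t] by (simp add: monom_deriv_def sum_nonneg)
next
  case False
  have u: "\<bar>u $ j\<bar> \<le> t" for j using component_le_norm_cart[of u j] t by simp
  have split: "(\<Sum>j\<in>UNIV. \<alpha> j) = \<alpha> i + (\<Sum>j\<in>UNIV - {i}. \<alpha> j)"
    by (simp add: sum.remove)
  have "\<bar>monom_deriv \<alpha> i u\<bar> = real (\<alpha> i) * \<bar>u $ i\<bar> ^ (\<alpha> i - 1) * (\<Prod>j\<in>UNIV - {i}. \<bar>u $ j\<bar> ^ \<alpha> j)"
    by (simp add: monom_deriv_def abs_mult power_abs abs_prod)
  also have "\<dots> \<le> real (\<Sum>j\<in>UNIV. \<alpha> j) * t ^ (\<alpha> i - 1) * (\<Prod>j\<in>UNIV - {i}. t ^ \<alpha> j)"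
    using u order_trans[OF norm_ge_zero t]
    by (intro mult_mono prod_mono power_mono conjI) (auto simp: split sum_nonneg intro!: prod_nonneg mult_nonneg_nonneg add_nonneg_nonneg)
  also have "\<dots> = real (\<Sum>j\<in>UNIV. \<alpha> j) * t ^ ((\<Sum>j\<in>UNIV. \<alpha> j) - 1)"
    using False by (simp add: split power_sum[symmetric] power_add[symmetric])
  finally show ?thesis .
qed

text \<open>Differentiation lowers the \<open>i\<close>-th exponent by one, so the two sums differ
  by the injective reindexing that raises it. Multi-indices outside its range have
  \<open>\<alpha> i = 0\<close> and contribute zero.\<close>

lemma has_sum_monom_deriv_iff:
  "((\<lambda>\<alpha>. c \<alpha> * monom_deriv \<alpha> i u) has_sum l) UNIV \<longleftrightarrow>
   ((\<lambda>\<alpha>. shift_coeff i c \<alpha> * monom_val \<alpha> u) has_sum l) UNIV"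
proof -
  let ?s = "\<lambda>\<alpha> :: 'a \<Rightarrow> nat. \<alpha>(i := \<alpha> i + 1)"
  have inj: "inj ?s"
  proof (rule injI)
    fix \<alpha> \<beta> :: "'a \<Rightarrow> nat" assume eq: "?s \<alpha> = ?s \<beta>"
    show "\<alpha> = \<beta>"
    proof
      fix j show "\<alpha> j = \<beta> j" using fun_cong[OF eq, of j] by (auto split: if_splits)
    qed
  qed
  have zero: "c \<alpha> * monom_deriv \<alpha> i u = 0" if "\<alpha> \<notin> range ?s" for \<alpha>
  proof (cases "\<alpha> i")
    case (Suc k)
    then have "\<alpha> = ?s (\<alpha>(i := k))" by auto
    then show ?thesis using that by blast
  qed (simp add: monom_deriv_def)
  have eq: "(\<lambda>\<alpha>. c \<alpha> * monom_deriv \<alpha> i u) \<circ> ?s = (\<lambda>\<alpha>. shift_coeff i c \<alpha> * monom_val \<alpha> u)"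
  proof
    fix \<alpha> :: "'a \<Rightarrow> nat"
    have "monom_val \<alpha> u = u $ i ^ \<alpha> i * (\<Prod>j\<in>UNIV - {i}. (u $ j) ^ \<alpha> j)"
      by (simp add: monom_val_def prod.remove)
    then show "((\<lambda>\<alpha>. c \<alpha> * monom_deriv \<alpha> i u) \<circ> ?s) \<alpha> = shift_coeff i c \<alpha> * monom_val \<alpha> u"
      by (simp add: monom_deriv_def shift_coeff_def)
  qed
  have "((\<lambda>\<alpha>. c \<alpha> * monom_deriv \<alpha> i u) has_sum l) UNIV \<longleftrightarrow>
      ((\<lambda>\<alpha>. c \<alpha> * monom_deriv \<alpha> i u) has_sum l) (range ?s)"
    by (rule has_sum_cong_neutral) (use zero in auto)
  then show ?thesis
    unfolding has_sum_reindex[OF inj] eq .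
qed

text \<open>The sequence \<open>n * (t / s) ^ n\<close> tends to zero and is therefore bounded.
  Passing to a smaller radius thus absorbs the factor produced by differentiation.\<close>

lemma linear_times_power_bounded:
  fixes s t :: real
  assumes "0 < t" "t < s"
  obtains K where "\<And>n. real n * t ^ (n - 1) \<le> K * s ^ n"
proof -
  have "(\<lambda>n. real n * (t / s) ^ n) \<longlonglongrightarrow> 0"
    using assms powser_times_n_limit_0[of "t / s"] by simp
  then have "Bseq (\<lambda>n. real n * (t / s) ^ n)"
    using convergent_imp_Bseq convergentI by blast
  then obtain K where K: "\<And>n. norm (real n * (t / s) ^ n) \<le> K"
    using BseqE by blast
  have "real n * t ^ (n - 1) \<le> K / t * s ^ n" for n
  proof (cases n)
    case 0
    have "0 \<le> K" using K[of 0] by simp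
    then show ?thesis using 0 assms by simp
  next
    case (Suc m)
    have "real n * (t / s) ^ n \<le> K" using K[of n] by (simp add: abs_le_iff)
    then show ?thesis
      using assms Suc by (simp add: power_divide field_simps)
  qed
  then show ?thesis using that by blast
qed

text \<open>The constant multi-indices are already infinitely many; this permits the enumeration in
  \<open>has_derivative_has_sum\<close>.\<close>

lemma infinite_multi_indices: "infinite (UNIV :: ('n::finite \<Rightarrow> nat) set)"
proof
  assume "finite (UNIV :: ('n \<Rightarrow> nat) set)"
  then have "finite (range (\<lambda>k. (\<lambda>_. k) :: 'n \<Rightarrow> nat))"
    by (rule finite_subset[rotated]) simp
  moreover have "inj (\<lambda>k. (\<lambda>_. k) :: 'n \<Rightarrow> nat)"
    by (auto simp: inj_def dest: fun_cong)
  ultimately show False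
    using finite_imageD by blast
qed

text \<open>Convergence at the diagonal point with all coordinates \<open>s\<close> gives
  summability of \<open>\<bar>c \<alpha>\<bar>\<close> times \<open>s\<close> to the total degree.
  On a ball of smaller radius \<open>t\<close> this dominates the differentiated terms.\<close>

lemma power_series_has_derivative:
  fixes g :: "real^'n \<Rightarrow> real"
  assumes r: "r > 0" and g: "\<And>u. norm u < r \<Longrightarrow> ((\<lambda>\<alpha>. c \<alpha> * monom_val \<alpha> u) has_sum g u) UNIV"
  obtains t g' where "t > 0"
    "\<And>u. norm u < t \<Longrightarrow> (g has_derivative (\<lambda>h. \<Sum>i\<in>UNIV. h $ i * g' i u)) (at u)"
    "\<And>i u. norm u < t \<Longrightarrow> ((\<lambda>\<alpha>. shift_coeff i c \<alpha> * monom_val \<alpha> u) has_sum g' i u) UNIV"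
proof -
  \<comment> \<open>The norm is at most the sum of the absolute coordinates, so this choice keeps
    the diagonal point inside the ball of radius \<open>r\<close>.\<close>
  define s where "s = r / (2 * real CARD('n))"
  have s: "s > 0" using r by (simp add: s_def)
  have "norm (\<chi> i. s :: real^'n) \<le> (\<Sum>i\<in>(UNIV::'n set). s)"
    using norm_le_l1_cart[of "\<chi> i. s :: real^'n"] s by simp
  also have "\<dots> < r" using r by (simp add: s_def)
  finally have less: "norm (\<chi> i. s :: real^'n) < r" .
  have eq: "norm (c \<alpha> * monom_val \<alpha> (\<chi> i. s :: real^'n)) = \<bar>c \<alpha>\<bar> * s ^ (\<Sum>i\<in>UNIV. \<alpha> i)" for \<alpha>
    using s by (simp add: monom_val_def abs_mult power_sum abs_prod)
  have "(\<lambda>\<alpha>. c \<alpha> * monom_val \<alpha> (\<chi> i. s :: real^'n)) summable_on UNIV"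
    using g[OF less] summable_on_def by blast
  then have cs: "(\<lambda>\<alpha>. \<bar>c \<alpha>\<bar> * s ^ (\<Sum>i\<in>UNIV. \<alpha> i)) summable_on UNIV"
    by (subst (asm) summable_on_iff_abs_summable_on_real) (simp only: eq)
  have "1 \<le> real CARD('n)" by (simp add: Suc_le_eq)
  then have "r * 1 \<le> r * (2 * real CARD('n))" using r by (intro mult_left_mono) linarith+
  then have "s \<le> r" by (simp add: s_def divide_le_eq)
  define t where "t = s / 2"
  have t: "0 < t" "t < s" "t < r" using s \<open>s \<le> r\<close> by (auto simp: t_def)
  obtain K where K: "\<And>n. real n * t ^ (n - 1) \<le> K * s ^ n"
    using linear_times_power_bounded[OF t(1,2)] by blast
  define M where "M = (\<lambda>\<alpha>. \<bar>c \<alpha>\<bar> * s ^ (\<Sum>i\<in>(UNIV::'n set). \<alpha> i) * K)"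
  have M: "M summable_on UNIV"
    unfolding M_def by (rule summable_on_cmult_left[OF cs])
  have bound: "\<bar>c \<alpha> * monom_deriv \<alpha> i u\<bar> \<le> M \<alpha>" if "norm u < t" for \<alpha> i and u :: "real^'n"
    using mult_left_mono[OF order_trans[OF monom_deriv_bound[of u t \<alpha> i] K], of "\<bar>c \<alpha>\<bar>"] that
    by (simp add: M_def abs_mult algebra_simps)
  show ?thesis
  proof
    show "t > 0" by fact
    fix u :: "real^'n" assume u: "norm u < t"
    have "(\<lambda>\<alpha>. c \<alpha> * monom_deriv \<alpha> i u) summable_on UNIV" for i
      by (rule summable_on_comparison_real[OF M]) (use bound[OF u] in auto)
    then show "((\<lambda>\<alpha>. shift_coeff i c \<alpha> * monom_val \<alpha> u) has_sum (\<Sum>\<^sub>\<infinity>\<alpha>. c \<alpha> * monom_deriv \<alpha> i u)) UNIV" for i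
      unfolding has_sum_monom_deriv_iff[symmetric] by simp
    show "(g has_derivative (\<lambda>h. \<Sum>i\<in>UNIV. h $ i * (\<Sum>\<^sub>\<infinity>\<alpha>. c \<alpha> * monom_deriv \<alpha> i u))) (at u)"
    proof (rule has_derivative_has_sum[OF infinite_multi_indices, where S = "ball 0 t"])
      show "u \<in> ball 0 t" using u by simp
      fix \<alpha> :: "'n \<Rightarrow> nat" and v :: "real^'n"
      show "((\<lambda>u. c \<alpha> * monom_val \<alpha> u) has_derivative (\<lambda>h. \<Sum>i\<in>UNIV. h $ i * (c \<alpha> * monom_deriv \<alpha> i v))) (at v)"
        by (rule has_derivative_eq_rhs[OF has_derivative_mult_right[OF has_derivative_monom_val]])
          (auto simp: sum_distrib_left algebra_simps)
    qed (use bound M g t in auto)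
  qed
qed

section \<open>Partial derivatives of real analytic functions\<close>

lemma has_derivative_partial_deriv:
  assumes "(f has_derivative f') (at x)"
  shows "partial_deriv i f x = f' (axis i 1)"
proof -
  have "((\<lambda>t. x + t *\<^sub>R axis i 1) has_derivative (\<lambda>t. t *\<^sub>R axis i 1)) (at 0)"
    by (auto intro!: derivative_eq_intros)
  moreover have "(f has_derivative f') (at (x + 0 *\<^sub>R axis i 1))" using assms by simp
  ultimately have "((\<lambda>t. f (x + t *\<^sub>R axis i 1)) has_derivative (\<lambda>t. f' (t *\<^sub>R axis i 1))) (at 0)"
    using has_derivative_compose by blast
  moreover have "f' (t *\<^sub>R axis i 1) = t * f' (axis i 1)" for t
    using assms by (simp add: has_derivative_def bounded_linear.linear linear_cmul)
  ultimately show ?thesis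
    unfolding partial_deriv_def
    by (intro DERIV_imp_deriv has_derivative_imp_has_field_derivative[where D = "\<lambda>t. t * f' (axis i 1)"]) auto
qed

lemma differentiable_has_derivative_partial:
  fixes f :: "real^'n \<Rightarrow> real"
  assumes "f differentiable at x"
  shows "(f has_derivative (\<lambda>h. \<Sum>i\<in>UNIV. h $ i * partial_deriv i f x)) (at x)"
proof -
  obtain f' where f': "(f has_derivative f') (at x)"
    using assms by (auto simp: differentiable_def)
  have "f' h = (\<Sum>i\<in>UNIV. h $ i * partial_deriv i f x)" for h
  proof -
    have "f' h = f' (\<Sum>i\<in>UNIV. h $ i *\<^sub>R axis i 1)"
      by (simp add: basis_expansion[of h, unfolded scalar_mult_eq_scaleR])
    also have "\<dots> = (\<Sum>i\<in>UNIV. h $ i * f' (axis i 1))"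
      using f' by (simp add: has_derivative_def bounded_linear.linear linear_sum linear_cmul)
    finally show ?thesis by (simp add: has_derivative_partial_deriv[OF f'])
  qed
  then have "f' = (\<lambda>h. \<Sum>i\<in>UNIV. h $ i * partial_deriv i f x)" by blast
  with f' show ?thesis by simp
qed

text \<open>Unlike in \<open>real_analytic_on\<close>, the expansion must hold on a full ball; for
  open \<open>X\<close> shrinking the radius reconciles the two. Naming the coefficients allows them
  to be followed through differentiation.\<close>

definition has_expansion :: "(real^'n \<Rightarrow> real) \<Rightarrow> (('n \<Rightarrow> nat) \<Rightarrow> real) \<Rightarrow> real^'n \<Rightarrow> real \<Rightarrow> bool" where
  "has_expansion f c x r \<longleftrightarrow> r > 0 \<and>
     (\<forall>y \<in> ball x r. ((\<lambda>\<alpha>. c \<alpha> * (\<Prod>i\<in>UNIV. (y $ i - x $ i) ^ \<alpha> i)) has_sum f y) UNIV)"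

lemma has_expansion_partial_deriv:
  assumes f: "has_expansion f c x r"
  obtains t where "\<And>y. y \<in> ball x t \<Longrightarrow> f differentiable at y"
    "\<And>i. has_expansion (partial_deriv i f) (shift_coeff i c) x t"
proof -
  have r: "r > 0" using f by (simp add: has_expansion_def)
  have "((\<lambda>\<alpha>. c \<alpha> * monom_val \<alpha> u) has_sum f (x + u)) UNIV" if "norm u < r" for u
  proof -
    have "x + u \<in> ball x r" using that by (simp add: dist_norm)
    from f[unfolded has_expansion_def, THEN conjunct2, rule_format, OF this] show ?thesis
      by (simp add: monom_val_def)
  qed
  from power_series_has_derivative[OF r this]
  obtain t g' where t: "t > 0"
    and g': "\<And>u. norm u < t \<Longrightarrow> ((\<lambda>u. f (x + u)) has_derivative (\<lambda>h. \<Sum>i\<in>UNIV. h $ i * g' i u)) (at u)"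
      "\<And>i u. norm u < t \<Longrightarrow> ((\<lambda>\<alpha>. shift_coeff i c \<alpha> * monom_val \<alpha> u) has_sum g' i u) UNIV"
    by blast
  have df: "(f has_derivative (\<lambda>h. \<Sum>i\<in>UNIV. h $ i * g' i (y - x))) (at y)" if y: "y \<in> ball x t" for y
  proof -
    have "norm (y - x) < t" using y by (simp add: dist_norm norm_minus_commute)
    note 1 = g'(1)[OF this]
    have "((\<lambda>y. y - x) has_derivative (\<lambda>h. h)) (at y)"
      by (auto intro!: derivative_eq_intros)
    from has_derivative_compose[OF this 1] show ?thesis by simp
  qed
  show ?thesis
  proof (rule that[of t])
    show "f differentiable at y" if "y \<in> ball x t" for y
      using df[OF that] differentiable_def by blast
    show "has_expansion (partial_deriv i f) (shift_coeff i c) x t" for i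
      unfolding has_expansion_def
    proof (intro conjI ballI t)
      fix y assume y: "y \<in> ball x t"
      have "partial_deriv i f y = g' i (y - x)"
        unfolding has_derivative_partial_deriv[OF df[OF y]]
        by (simp add: axis_def if_distrib[of "\<lambda>a. a * _"] cong: if_cong)
      then show "((\<lambda>\<alpha>. shift_coeff i c \<alpha> * (\<Prod>i\<in>UNIV. (y $ i - x $ i) ^ \<alpha> i)) has_sum partial_deriv i f y) UNIV"
        using g'(2)[of "y - x" i] y by (simp add: dist_norm norm_minus_commute monom_val_def)
    qed
  qed
qed

lemma real_analytic_on_iff_has_expansion:
  assumes "open X"
  shows "real_analytic_on f X \<longleftrightarrow> (\<forall>x\<in>X. \<exists>r c. has_expansion f c x r)"
proof (intro iffI ballI)
  fix x assume f: "real_analytic_on f X" and x: "x \<in> X"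
  obtain e where e: "e > 0" "ball x e \<subseteq> X"
    using assms x openE by blast
  obtain r c where "r > 0" "\<forall>y \<in> X \<inter> ball x r.
     ((\<lambda>\<alpha>. c \<alpha> * (\<Prod>i\<in>UNIV. (y $ i - x $ i) ^ \<alpha> i)) has_sum f y) UNIV"
    using f x unfolding real_analytic_on_def by blast
  then have "has_expansion f c x (min r e)"
    using e by (auto simp: has_expansion_def)
  then show "\<exists>r c. has_expansion f c x r" by blast
next
  assume "\<forall>x\<in>X. \<exists>r c. has_expansion f c x r"
  then show "real_analytic_on f X"
    unfolding real_analytic_on_def has_expansion_def by blast
qed

lemma real_analytic_on_differentiable:
  assumes "real_analytic_on f X" "open X" "x \<in> X"
  shows "f differentiable at x"
proof -
  obtain r c where "has_expansion f c x r"
    using assms real_analytic_on_iff_has_expansion by blast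
  \<comment> \<open>Positivity of \<open>t\<close>, which puts \<open>x\<close> into the ball, is
    contained in the second fact.\<close>
  then obtain t where "\<And>y. y \<in> ball x t \<Longrightarrow> f differentiable at y"
      and "\<And>i. has_expansion (partial_deriv i f) (shift_coeff i c) x t"
    using has_expansion_partial_deriv by blast
  then show ?thesis by (simp add: has_expansion_def)
qed

lemma real_analytic_on_partial_deriv:
  assumes "real_analytic_on f X" "open X"
  shows "real_analytic_on (partial_deriv i f) X"
  unfolding real_analytic_on_iff_has_expansion[OF assms(2)]
proof
  fix x assume "x \<in> X"
  then obtain r c where "has_expansion f c x r"
    using assms real_analytic_on_iff_has_expansion by blast
  then show "\<exists>r c. has_expansion (partial_deriv i f) c x r"
    using has_expansion_partial_deriv by blast
qed

text \<open>Symmetry is read off the power series: both iterated derivatives have expansions at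
  \<open>x\<close> with the same coefficients, by \<open>shift_coeff_commute\<close>, and are
  compared at the centre.\<close>

lemma partial_deriv_commute:
  assumes "real_analytic_on f X" "open X" "x \<in> X"
  shows "partial_deriv i (partial_deriv j f) x = partial_deriv j (partial_deriv i f) x"
proof -
  obtain r c where "has_expansion f c x r"
    using assms real_analytic_on_iff_has_expansion by blast
  then obtain t where "\<And>k. has_expansion (partial_deriv k f) (shift_coeff k c) x t"
    using has_expansion_partial_deriv by blast
  then have "\<exists>s. has_expansion (partial_deriv l (partial_deriv k f)) (shift_coeff l (shift_coeff k c)) x s" for k l
    using has_expansion_partial_deriv by blast
  then have "((\<lambda>\<alpha>. shift_coeff l (shift_coeff k c) \<alpha> * (\<Prod>i\<in>UNIV. (x $ i - x $ i) ^ \<alpha> i))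
      has_sum partial_deriv l (partial_deriv k f) x) UNIV" for k l
    unfolding has_expansion_def using centre_in_ball by blast
  from this[of i j] this[of j i] show ?thesis
    unfolding shift_coeff_commute[of i j] by (rule has_sum_unique)
qed

section \<open>Polynomials and their chain rule\<close>

definition monomial_eval :: "('v \<Rightarrow>\<^sub>0 nat) \<Rightarrow> ('v \<Rightarrow> real) \<Rightarrow> real" where
  "monomial_eval m v = (\<Prod>x\<in>Poly_Mapping.keys m. v x ^ Poly_Mapping.lookup m x)"

lemma monomial_eval_superset:
  assumes "finite V" "Poly_Mapping.keys m \<subseteq> V"
  shows "monomial_eval m v = (\<Prod>x\<in>V. v x ^ Poly_Mapping.lookup m x)"
  unfolding monomial_eval_def
  by (rule prod.mono_neutral_left) (use assms in \<open>auto simp: in_keys_iff\<close>)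

lemma mpoly_eval_eq_monomial_eval:
  "mpoly_eval p v = (\<Sum>m\<in>Poly_Mapping.keys p. Poly_Mapping.lookup p m * monomial_eval m v)"
  by (simp add: mpoly_eval_def monomial_eval_def)

lemma mpoly_eval_superset:
  assumes "finite M" "Poly_Mapping.keys p \<subseteq> M"
  shows "mpoly_eval p v = (\<Sum>m\<in>M. Poly_Mapping.lookup p m * monomial_eval m v)"
  unfolding mpoly_eval_eq_monomial_eval
  by (rule sum.mono_neutral_left) (use assms in \<open>auto simp: in_keys_iff\<close>)

lemma mpoly_eval_0 [simp]: "mpoly_eval 0 v = 0"
  by (simp add: mpoly_eval_def)

lemma mpoly_eval_add: "mpoly_eval (p + q) v = mpoly_eval p v + mpoly_eval q v"
proof -
  let ?M = "Poly_Mapping.keys p \<union> Poly_Mapping.keys q"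
  have "mpoly_eval r v = (\<Sum>m\<in>?M. Poly_Mapping.lookup r m * monomial_eval m v)"
    if "Poly_Mapping.keys r \<subseteq> ?M" for r
    by (rule mpoly_eval_superset) (use that in auto)
  from this[of p] this[of q] this[of "p + q"] show ?thesis
    using Poly_Mapping.keys_add[of p q] by (simp add: lookup_add algebra_simps sum.distrib)
qed

lemma mpoly_eval_sum: "mpoly_eval (\<Sum>a\<in>A. p a) v = (\<Sum>a\<in>A. mpoly_eval (p a) v)"
  by (induction A rule: infinite_finite_induct) (auto simp: mpoly_eval_add)

lemma mpoly_eval_single: "mpoly_eval (Poly_Mapping.single m c) v = c * monomial_eval m v"
  by (subst mpoly_eval_superset[where M = "{m}"]) auto

lemma mpoly_eval_pderiv:
  "mpoly_eval (mpoly_pderiv x p) v = (\<Sum>m\<in>Poly_Mapping.keys p. Poly_Mapping.lookup p m *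
     (real (Poly_Mapping.lookup m x) * monomial_eval (m - Poly_Mapping.single x 1) v))"
  by (simp add: mpoly_pderiv_def mpoly_eval_sum mpoly_eval_single mult.assoc)

lemma keys_minus_single_subset:
  "Poly_Mapping.keys (m - Poly_Mapping.single x 1 :: 'v \<Rightarrow>\<^sub>0 nat) \<subseteq> Poly_Mapping.keys m"
  by (auto simp: in_keys_iff lookup_minus)

lemma mpoly_vars_pderiv: "mpoly_vars (mpoly_pderiv x p) \<subseteq> mpoly_vars p"
proof -
  have "Poly_Mapping.keys (mpoly_pderiv x p) \<subseteq>
      (\<Union>m\<in>Poly_Mapping.keys p. {m - Poly_Mapping.single x 1})"
    unfolding mpoly_pderiv_def
    by (rule order_trans[OF Poly_Mapping.keys_sum]) (auto split: if_splits)
  then show ?thesis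
    using keys_minus_single_subset[of _ x] by (fastforce simp: mpoly_vars_def)
qed

text \<open>The right-hand side has the shape that the product rule for \<open>monomial_eval\<close>
  produces.\<close>

lemma monomial_eval_pderiv:
  "real (Poly_Mapping.lookup m x) * monomial_eval (m - Poly_Mapping.single x 1) v =
   (if x \<in> Poly_Mapping.keys m then real (Poly_Mapping.lookup m x) * v x ^ (Poly_Mapping.lookup m x - 1) *
     (\<Prod>y\<in>Poly_Mapping.keys m - {x}. v y ^ Poly_Mapping.lookup m y) else 0)"
proof (cases "x \<in> Poly_Mapping.keys m")
  case True
  have "monomial_eval (m - Poly_Mapping.single x 1) v =
      (\<Prod>y\<in>Poly_Mapping.keys m. v y ^ Poly_Mapping.lookup (m - Poly_Mapping.single x 1) y)"
    by (rule monomial_eval_superset[OF _ keys_minus_single_subset]) simp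
  also have "\<dots> = v x ^ (Poly_Mapping.lookup m x - 1) * (\<Prod>y\<in>Poly_Mapping.keys m - {x}. v y ^ Poly_Mapping.lookup m y)"
    using True by (subst prod.remove[of _ x]) (auto simp: lookup_minus lookup_single intro!: prod.cong)
  finally show ?thesis using True by simp
qed (simp add: in_keys_iff)

text \<open>The product rule applies to each monomial; exchanging the sums over monomials and
  variables then collects the formal partial derivatives.\<close>

lemma has_derivative_mpoly_eval:
  fixes u :: "'a::real_normed_vector \<Rightarrow> 'v \<Rightarrow> real"
  assumes V: "finite V" "mpoly_vars p \<subseteq> V"
    and u: "\<And>x. x \<in> V \<Longrightarrow> ((\<lambda>t. u t x) has_derivative u' x) (at a)"
  shows "((\<lambda>t. mpoly_eval p (u t)) has_derivative
    (\<lambda>h. \<Sum>x\<in>V. mpoly_eval (mpoly_pderiv x p) (u a) * u' x h)) (at a)"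
proof -
  let ?d = "\<lambda>m x. real (Poly_Mapping.lookup m x) * monomial_eval (m - Poly_Mapping.single x 1) (u a)"
  have "((\<lambda>t. monomial_eval m (u t)) has_derivative (\<lambda>h. \<Sum>x\<in>V. ?d m x * u' x h)) (at a)"
    if m: "m \<in> Poly_Mapping.keys p" for m
  proof -
    have keys: "Poly_Mapping.keys m \<subseteq> V"
      using m V by (auto simp: mpoly_vars_def)
    have "((\<lambda>t. monomial_eval m (u t)) has_derivative (\<lambda>h. \<Sum>x\<in>Poly_Mapping.keys m.
        (real (Poly_Mapping.lookup m x) * u' x h * u a x ^ (Poly_Mapping.lookup m x - 1)) *
        (\<Prod>y\<in>Poly_Mapping.keys m - {x}. u a y ^ Poly_Mapping.lookup m y))) (at a)"
      unfolding monomial_eval_def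
      by (rule has_derivative_prod, rule has_derivative_power, rule u) (use keys in auto)
    also have "(\<lambda>h. \<Sum>x\<in>Poly_Mapping.keys m.
        (real (Poly_Mapping.lookup m x) * u' x h * u a x ^ (Poly_Mapping.lookup m x - 1)) *
        (\<Prod>y\<in>Poly_Mapping.keys m - {x}. u a y ^ Poly_Mapping.lookup m y)) =
        (\<lambda>h. \<Sum>x\<in>V. ?d m x * u' x h)"
    proof
      fix h
      show "(\<Sum>x\<in>Poly_Mapping.keys m.
        (real (Poly_Mapping.lookup m x) * u' x h * u a x ^ (Poly_Mapping.lookup m x - 1)) *
        (\<Prod>y\<in>Poly_Mapping.keys m - {x}. u a y ^ Poly_Mapping.lookup m y)) = (\<Sum>x\<in>V. ?d m x * u' x h)"
        unfolding monomial_eval_pderiv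
        by (rule sum.mono_neutral_cong_left) (use keys V in auto)
    qed
    finally show ?thesis .
  qed
  then have "((\<lambda>t. \<Sum>m\<in>Poly_Mapping.keys p. Poly_Mapping.lookup p m * monomial_eval m (u t)) has_derivative
      (\<lambda>h. \<Sum>m\<in>Poly_Mapping.keys p. Poly_Mapping.lookup p m * (\<Sum>x\<in>V. ?d m x * u' x h))) (at a)"
    by (intro has_derivative_sum has_derivative_mult_right)
  also have "(\<lambda>h. \<Sum>m\<in>Poly_Mapping.keys p. Poly_Mapping.lookup p m * (\<Sum>x\<in>V. ?d m x * u' x h)) =
      (\<lambda>h. \<Sum>x\<in>V. mpoly_eval (mpoly_pderiv x p) (u a) * u' x h)"
    unfolding mpoly_eval_pderiv sum_distrib_left sum_distrib_right
    by (subst sum.swap) (simp add: mult.assoc)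
  finally show ?thesis
    by (simp add: mpoly_eval_eq_monomial_eval)
qed

lemma monomial_eval_add: "monomial_eval (m + n) v = monomial_eval m v * monomial_eval n v"
proof -
  let ?V = "Poly_Mapping.keys m \<union> Poly_Mapping.keys n"
  have "monomial_eval k v = (\<Prod>x\<in>?V. v x ^ Poly_Mapping.lookup k x)" if "Poly_Mapping.keys k \<subseteq> ?V" for k
    by (rule monomial_eval_superset) (use that in auto)
  from this[of m] this[of n] this[of "m + n"] show ?thesis
    using Poly_Mapping.keys_add[of m n] by (simp add: lookup_add power_add prod.distrib)
qed

lemma monomial_eval_0: "monomial_eval 0 v = 1"
  by (simp add: monomial_eval_def)

lemma monomial_eval_single: "monomial_eval (Poly_Mapping.single x k) v = v x ^ k"
  by (subst monomial_eval_superset[where V = "{x}"]) auto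

lemma mpoly_vars_single: "mpoly_vars (Poly_Mapping.single m c) \<subseteq> Poly_Mapping.keys m"
  by (auto simp: mpoly_vars_def)

lemma mpoly_vars_add: "mpoly_vars (p + q) \<subseteq> mpoly_vars p \<union> mpoly_vars q"
  unfolding mpoly_vars_def using Poly_Mapping.keys_add[of p q] by blast

lemma mpoly_vars_0: "mpoly_vars 0 = {}"
  by (simp add: mpoly_vars_def)

lemma mpoly_vars_sum: "mpoly_vars (\<Sum>a\<in>A. p a) \<subseteq> (\<Union>a\<in>A. mpoly_vars (p a))"
proof (induction A rule: infinite_finite_induct)
  case (insert a A)
  then show ?case using mpoly_vars_add[of "p a" "\<Sum>a\<in>A. p a"] by auto
qed (auto simp: mpoly_vars_0)

lemma mpoly_degree_le_0: "mpoly_degree_le d 0"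
  by (simp add: mpoly_degree_le_def)

lemma mpoly_degree_le_add: "mpoly_degree_le d p \<Longrightarrow> mpoly_degree_le d q \<Longrightarrow> mpoly_degree_le d (p + q)"
  unfolding mpoly_degree_le_def using Poly_Mapping.keys_add[of p q] by blast

lemma mpoly_degree_le_sum: "(\<And>a. a \<in> A \<Longrightarrow> mpoly_degree_le d (p a)) \<Longrightarrow> mpoly_degree_le d (\<Sum>a\<in>A. p a)"
  by (induction A rule: infinite_finite_induct) (auto intro: mpoly_degree_le_0 mpoly_degree_le_add)

section \<open>Algebras of functions and partial derivatives\<close>

text \<open>For small \<open>t\<close> the point \<open>x + t *\<^sub>R axis i 1\<close> stays in
  the open set \<open>X\<close>, so the two difference quotients agree near zero.\<close>

lemma partial_deriv_cong:
  assumes "open X" "x \<in> X" "\<And>y. y \<in> X \<Longrightarrow> f y = g y"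
  shows "partial_deriv i f x = partial_deriv i g x"
proof -
  have "\<forall>\<^sub>F t in nhds 0. x + t *\<^sub>R axis i 1 \<in> X"
    using assms(1,2) by (intro topological_tendstoD[where l = x]) (auto intro!: tendsto_eq_intros filterlim_ident)
  then have "\<forall>\<^sub>F t in nhds 0. f (x + t *\<^sub>R axis i 1) = g (x + t *\<^sub>R axis i 1)"
    by eventually_elim (rule assms(3))
  then show ?thesis
    unfolding partial_deriv_def by (rule deriv_cong_ev) simp
qed

lemma differentiable_cong_open:
  assumes "open X" "x \<in> X" "\<And>y. y \<in> X \<Longrightarrow> f y = g y" "f differentiable at x"
  shows "g differentiable at x"
  using assms has_derivative_transform_within_open unfolding differentiable_def by blast

lemma has_derivative_coordinate: "((\<lambda>x. x $ j) has_derivative (\<lambda>h. h $ j)) (at x)"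
  by (rule bounded_linear_imp_has_derivative[OF bounded_linear_vec_nth])

lemma partial_deriv_coordinate: "partial_deriv i (\<lambda>x. x $ j) x = (if i = j then 1 else 0)"
  by (simp add: has_derivative_partial_deriv[OF has_derivative_coordinate] axis_def)

lemma partial_deriv_const: "partial_deriv i (\<lambda>_. c) x = 0"
  by (simp add: has_derivative_partial_deriv[OF has_derivative_const])

lemma partial_deriv_add:
  assumes "f differentiable at x" "g differentiable at x"
  shows "partial_deriv i (\<lambda>x. f x + g x) x = partial_deriv i f x + partial_deriv i g x"
proof -
  obtain f' g' where *: "(f has_derivative f') (at x)" "(g has_derivative g') (at x)"
    using assms by (auto simp: differentiable_def)
  show ?thesis
    by (simp add: has_derivative_partial_deriv[OF has_derivative_add[OF *]]
        has_derivative_partial_deriv[OF *(1)] has_derivative_partial_deriv[OF *(2)])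
qed

lemma partial_deriv_mult:
  fixes f g :: "real^'n \<Rightarrow> real"
  assumes "f differentiable at x" "g differentiable at x"
  shows "partial_deriv i (\<lambda>x. f x * g x) x = f x * partial_deriv i g x + partial_deriv i f x * g x"
proof -
  obtain f' g' where *: "(f has_derivative f') (at x)" "(g has_derivative g') (at x)"
    using assms by (auto simp: differentiable_def)
  show ?thesis
    by (simp add: has_derivative_partial_deriv[OF has_derivative_mult[OF *]]
        has_derivative_partial_deriv[OF *(1)] has_derivative_partial_deriv[OF *(2)])
qed

lemma partial_deriv_inverse:
  fixes f :: "real^'n \<Rightarrow> real"
  assumes "f differentiable at x" "f x \<noteq> 0"
  shows "partial_deriv i (\<lambda>x. inverse (f x)) x = - (inverse (f x) * inverse (f x) * partial_deriv i f x)"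
proof -
  obtain f' where *: "(f has_derivative f') (at x)"
    using assms by (auto simp: differentiable_def)
  show ?thesis
    by (simp add: has_derivative_partial_deriv[OF Deriv.has_derivative_inverse[OF assms(2) *]]
        has_derivative_partial_deriv[OF *])
qed

lemma partial_deriv_mpoly_eval:
  assumes "finite V" "mpoly_vars p \<subseteq> V" "\<And>x. x \<in> V \<Longrightarrow> (\<lambda>t. u t x) differentiable at a"
  shows "partial_deriv i (\<lambda>t. mpoly_eval p (u t)) a =
    (\<Sum>x\<in>V. mpoly_eval (mpoly_pderiv x p) (u a) * partial_deriv i (\<lambda>t. u t x) a)"
proof -
  obtain u' where u': "\<And>x. x \<in> V \<Longrightarrow> ((\<lambda>t. u t x) has_derivative u' x) (at a)"
    using assms(3) unfolding differentiable_def by metis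
  show ?thesis
    by (simp add: has_derivative_partial_deriv[OF has_derivative_mpoly_eval[OF assms(1,2) u']]
        has_derivative_partial_deriv[OF u'])
qed

text \<open>Only the values on \<open>X\<close> matter: the algebra is saturated under equality on \<open>X\<close>.\<close>

inductive_set fun_algebra :: "'a set \<Rightarrow> ('a \<Rightarrow> real) set \<Rightarrow> ('a \<Rightarrow> real) set"
  for X G where
  generator: "g \<in> G \<Longrightarrow> g \<in> fun_algebra X G"
| const: "(\<lambda>_. c) \<in> fun_algebra X G"
| add: "f \<in> fun_algebra X G \<Longrightarrow> g \<in> fun_algebra X G \<Longrightarrow> (\<lambda>x. f x + g x) \<in> fun_algebra X G"
| mult: "f \<in> fun_algebra X G \<Longrightarrow> g \<in> fun_algebra X G \<Longrightarrow> (\<lambda>x. f x * g x) \<in> fun_algebra X G"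
| cong: "f \<in> fun_algebra X G \<Longrightarrow> (\<And>x. x \<in> X \<Longrightarrow> f x = g x) \<Longrightarrow> g \<in> fun_algebra X G"

lemma fun_algebra_uminus: "f \<in> fun_algebra X G \<Longrightarrow> (\<lambda>x. - f x) \<in> fun_algebra X G"
  using fun_algebra.mult[OF fun_algebra.const[of "-1"]] by simp

lemma fun_algebra_sum:
  "(\<And>a. a \<in> A \<Longrightarrow> f a \<in> fun_algebra X G) \<Longrightarrow> (\<lambda>x. \<Sum>a\<in>A. f a x) \<in> fun_algebra X G"
  by (induction A rule: infinite_finite_induct) (auto intro: fun_algebra.intros(2-4))

lemma fun_algebra_prod:
  "(\<And>a. a \<in> A \<Longrightarrow> f a \<in> fun_algebra X G) \<Longrightarrow> (\<lambda>x. \<Prod>a\<in>A. f a x) \<in> fun_algebra X G"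
  by (induction A rule: infinite_finite_induct) (auto intro: fun_algebra.intros(2-4))

lemma fun_algebra_power: "f \<in> fun_algebra X G \<Longrightarrow> (\<lambda>x. f x ^ k) \<in> fun_algebra X G"
  by (induction k) (auto intro: fun_algebra.intros(2-4))

lemma fun_algebra_mpoly_eval:
  assumes "\<And>y. y \<in> mpoly_vars p \<Longrightarrow> (\<lambda>x. u x y) \<in> fun_algebra X G"
  shows "(\<lambda>x. mpoly_eval p (u x)) \<in> fun_algebra X G"
  unfolding mpoly_eval_def
  by (intro fun_algebra_sum fun_algebra.mult fun_algebra.const fun_algebra_prod fun_algebra_power assms)
    (auto simp: mpoly_vars_def)

lemma fun_algebra_least:
  assumes "f \<in> fun_algebra X G" "G \<subseteq> fun_algebra X H"
  shows "f \<in> fun_algebra X H"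
  using assms(1) by induction (use assms(2) in \<open>auto intro: fun_algebra.intros(2-5)\<close>)

lemma fun_algebra_mono:
  assumes "f \<in> fun_algebra X G" "G \<subseteq> H"
  shows "f \<in> fun_algebra X H"
  using assms fun_algebra_least fun_algebra.generator by blast

text \<open>The sum and product rules reduce the claim to generators; differentiability is carried
  along because these rules require it. A separate \<open>H\<close> lets the derivatives land in a
  larger algebra than the one of \<open>f\<close>.\<close>

lemma fun_algebra_partial_deriv:
  assumes X: "open X" and f: "f \<in> fun_algebra X G"
    and G: "\<And>g x. g \<in> G \<Longrightarrow> x \<in> X \<Longrightarrow> g differentiable at x"
    and H: "G \<subseteq> fun_algebra X H" "\<And>g. g \<in> G \<Longrightarrow> partial_deriv i g \<in> fun_algebra X H"
  shows "(\<forall>x\<in>X. f differentiable at x) \<and> partial_deriv i f \<in> fun_algebra X H"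
  using f
proof induction
  case (generator g)
  then show ?case using G H by blast
next
  case (const c)
  have "partial_deriv i (\<lambda>_. c) = (\<lambda>_. 0)" by (simp add: fun_eq_iff partial_deriv_const)
  then show ?case by (simp add: fun_algebra.const)
next
  case (add f g)
  have "partial_deriv i (\<lambda>x. f x + g x) \<in> fun_algebra X H"
    by (rule fun_algebra.cong[OF fun_algebra.add[of "partial_deriv i f" _ _ "partial_deriv i g"]])
      (use add in \<open>auto simp: partial_deriv_add\<close>)
  then show ?case using add by simp
next
  case (mult f g)
  have "(\<lambda>x. f x * partial_deriv i g x + partial_deriv i f x * g x) \<in> fun_algebra X H"
    using mult fun_algebra_least[OF _ H(1)] by (intro fun_algebra.add fun_algebra.mult) auto
  then have "partial_deriv i (\<lambda>x. f x * g x) \<in> fun_algebra X H"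
    by (rule fun_algebra.cong) (use mult in \<open>auto simp: partial_deriv_mult\<close>)
  then show ?case using mult by simp
next
  case (cong f g)
  have "partial_deriv i g \<in> fun_algebra X H"
    using cong by (auto intro: fun_algebra.cong[of "partial_deriv i f"] partial_deriv_cong[OF X])
  then show ?case using cong differentiable_cong_open[OF X] by blast
qed

section \<open>Closing the jets of a nonsingular DA function under differentiation\<close>

text \<open>A word lists the directions of differentiation; its head is the derivative taken
  last.\<close>

definition iter_partial :: "'n list \<Rightarrow> (real^'n \<Rightarrow> real) \<Rightarrow> real^'n \<Rightarrow> real" where
  "iter_partial w f = foldr partial_deriv w f"

lemma iter_partial_simps [simp]:
  "iter_partial [] f = f"
  "iter_partial (i # w) f = partial_deriv i (iter_partial w f)"
  "iter_partial (v @ w) f = iter_partial v (iter_partial w f)"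
  by (simp_all add: iter_partial_def)

lemma iter_partial_replicate: "iter_partial (replicate k i) f = (partial_deriv i ^^ k) f"
  by (induction k) auto

lemma real_analytic_on_iter_partial:
  "real_analytic_on f X \<Longrightarrow> open X \<Longrightarrow> real_analytic_on (iter_partial w f) X"
  by (induction w) (auto intro: real_analytic_on_partial_deriv)

lemma iter_partial_cong:
  assumes "open X" "\<And>y. y \<in> X \<Longrightarrow> f y = g y"
  shows "x \<in> X \<Longrightarrow> iter_partial w f x = iter_partial w g x"
proof (induction w arbitrary: x)
  case (Cons i w)
  then have "partial_deriv i (iter_partial w f) x = partial_deriv i (iter_partial w g) x"
    by (intro partial_deriv_cong[OF assms(1)])
  then show ?case by simp
qed (simp add: assms)

lemma iter_partial_move:
  assumes f: "real_analytic_on f X" and X: "open X"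
  shows "x \<in> X \<Longrightarrow> iter_partial (v @ i # w) f x = iter_partial (i # v @ w) f x"
proof (induction v arbitrary: x)
  case (Cons j v)
  have "partial_deriv j (iter_partial (v @ i # w) f) x = partial_deriv j (iter_partial (i # v @ w) f) x"
    by (intro partial_deriv_cong[OF X Cons.prems] Cons.IH)
  then have "iter_partial ((j # v) @ i # w) f x = partial_deriv j (iter_partial (i # v @ w) f) x" by simp
  also have "\<dots> = partial_deriv i (partial_deriv j (iter_partial (v @ w) f)) x"
    using partial_deriv_commute[OF real_analytic_on_iter_partial[OF f X, of "v @ w"] X Cons.prems, of j i] by simp
  finally show ?case by simp
qed simp

text \<open>Since partial derivatives commute on \<open>X\<close>, only the number of occurrences of
  each direction matters. Words are therefore compared through their multisets below.\<close>

lemma iter_partial_mset_eq: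
  assumes f: "real_analytic_on f X" and X: "open X"
  shows "mset v = mset w \<Longrightarrow> x \<in> X \<Longrightarrow> iter_partial v f x = iter_partial w f x"
proof (induction v arbitrary: w x)
  case (Cons i v)
  then have "i \<in> set w" by (metis list.set_intros(1) mset_eq_setD)
  then obtain w1 w2 where w: "w = w1 @ i # w2" by (meson split_list)
  then have "mset v = mset (w1 @ w2)" using Cons.prems(1) by simp
  then have "partial_deriv i (iter_partial v f) x = partial_deriv i (iter_partial (w1 @ w2) f) x"
    using Cons.IH by (intro partial_deriv_cong[OF X Cons.prems(2)]) blast
  then have "iter_partial (i # v) f x = iter_partial (i # w1 @ w2) f x" by simp
  then show ?case
    using iter_partial_move[OF f X Cons.prems(2), of w1 i w2] w by simp
qed simp

text \<open>For open \<open>X\<close> the Leibniz rule extends this from \<open>G\<close> to the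
  whole algebra: \<open>G\<close> generates an algebra stable under all partial derivatives.\<close>

definition closed_generators :: "(real^'n) set \<Rightarrow> (real^'n \<Rightarrow> real) set \<Rightarrow> bool" where
  "closed_generators X G \<longleftrightarrow> finite G \<and> (\<forall>g\<in>G. (\<forall>x\<in>X. g differentiable at x) \<and>
     (\<forall>i. partial_deriv i g \<in> fun_algebra X G))"

text \<open>Allows the components of a vector-valued map to be treated one at a time.\<close>

lemma closed_generators_UN:
  assumes "finite K" "\<And>k. k \<in> K \<Longrightarrow> closed_generators X (G k)"
  shows "closed_generators X (\<Union>k\<in>K. G k)"
  unfolding closed_generators_def
proof (intro conjI ballI allI)
  show "finite (\<Union>k\<in>K. G k)" using assms by (auto simp: closed_generators_def)
  fix g assume "g \<in> (\<Union>k\<in>K. G k)"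
  then obtain k where k: "k \<in> K" "g \<in> G k" by blast
  then show "g differentiable at x" if "x \<in> X" for x
    using assms(2)[OF k(1)] that by (auto simp: closed_generators_def)
  show "partial_deriv i g \<in> fun_algebra X (\<Union>k\<in>K. G k)" for i
    by (rule fun_algebra_mono[of _ _ "G k"]) (use assms(2)[OF k(1)] k in \<open>auto simp: closed_generators_def\<close>)
qed

text \<open>The only critical case is a mixed derivative already of order \<open>\<rho> i\<close> in
  direction \<open>i\<close> that is differentiated once more in that direction. \<open>top\<close>
  resolves the pure derivative of order \<open>\<rho> i + 1\<close>, \<open>over\<close> applies the
  other directions to it, and \<open>word_partial\<close> checks that all orders remain in the
  box.\<close>

lemma nonsingular_DA_function_closed_generators:
  fixes f :: "real^'n \<Rightarrow> real"
  assumes X: "open X" and f: "nonsingular_DA_function X f"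
  obtains G where "closed_generators X G" "f \<in> G"
proof -
  obtain \<rho> p where eq: "\<And>i. DA_equation X f i (\<rho> i) (p i)"
    and ns: "\<And>i x. x \<in> X \<Longrightarrow> mpoly_eval (mpoly_pderiv (Inr (\<rho> i)) (p i)) (jet f i x) \<noteq> 0"
    using f unfolding nonsingular_DA_function_def by metis
  have an: "real_analytic_on f X"
    using f by (simp add: nonsingular_DA_function_def DA_function_def)
  have diff: "iter_partial w f differentiable at x" if "x \<in> X" for w x
    using real_analytic_on_differentiable[OF real_analytic_on_iter_partial[OF an X] X that] .
  define V where "V i = (range Inl \<union> Inr ` {..\<rho> i} :: ('n + nat) set)" for i
  have V: "finite (V i)" "mpoly_vars (p i) \<subseteq> V i" for i
    using eq[of i] by (auto simp: V_def DA_equation_def)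
  have jet_Inl: "(\<lambda>x. jet f i x (Inl j)) = (\<lambda>x. x $ j)" for i j
    by (simp add: jet_def)
  have jet_Inr: "(\<lambda>x. jet f i x (Inr k)) = iter_partial (replicate k i) f" for i k
    by (simp add: jet_def iter_partial_replicate)
  define S where "S i x = mpoly_eval (mpoly_pderiv (Inr (\<rho> i)) (p i)) (jet f i x)" for i x
  define T where "T i x = inverse (S i x)" for i x
  define C where "C = range (\<lambda>j (x::real^'n). x $ j)"
  \<comment> \<open>The functions in which the \<open>i\<close>-th equation and its separant
    \<open>S i\<close> are polynomial.\<close>
  define base where "base i = C \<union> (\<lambda>k. iter_partial (replicate k i) f) ` {..\<rho> i}" for i
  have C_diff: "g differentiable at x" if "g \<in> C" for g x
    using that has_derivative_coordinate by (auto simp: C_def differentiable_def)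
  have C_partial: "partial_deriv i g \<in> fun_algebra X H" if g: "g \<in> C" for g i H
  proof -
    obtain j where "g = (\<lambda>x. x $ j)" using g by (auto simp: C_def)
    then have "partial_deriv i g = (\<lambda>_. if i = j then 1 else 0)"
      using partial_deriv_coordinate by blast
    then show ?thesis by (simp add: fun_algebra.const)
  qed
  have base_diff: "g differentiable at x" if "g \<in> base i" "x \<in> X" for g i x
    using that C_diff diff by (auto simp: base_def)
  have jet_base: "(\<lambda>x. jet f i x v) \<in> base i" if "v \<in> V i" for i v
    using that by (auto simp: V_def jet_Inl jet_Inr base_def C_def)
  have pderiv_base: "(\<lambda>x. mpoly_eval (mpoly_pderiv v (p i)) (jet f i x)) \<in> fun_algebra X (base i)" for v i
    by (rule fun_algebra_mpoly_eval, rule fun_algebra.generator, rule jet_base)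
      (use mpoly_vars_pderiv[of v "p i"] V in auto)
  have S_base: "S i \<in> fun_algebra X (base i)" for i
    unfolding S_def[abs_def] by (rule pderiv_base)
  have S_nz: "S i x \<noteq> 0" if "x \<in> X" for i x
    using ns[OF that] by (simp add: S_def)
  have S_partial: "(\<forall>x\<in>X. S i differentiable at x) \<and> partial_deriv j (S i) \<in> fun_algebra X H"
    if "base i \<subseteq> fun_algebra X H" "\<And>g. g \<in> base i \<Longrightarrow> partial_deriv j g \<in> fun_algebra X H" for i j H
    by (rule fun_algebra_partial_deriv[OF X S_base base_diff that])
  \<comment> \<open>Only differentiability is wanted here, so the direction is arbitrary and the
    target generators are enlarged until the hypotheses of \<open>S_partial\<close> hold
    trivially.\<close>
  have S_diff: "S i differentiable at x" if "x \<in> X" for i x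
    using that S_partial[of i "base i \<union> partial_deriv undefined ` base i" undefined]
    by (blast intro: fun_algebra.generator)
  have T_diff: "T i differentiable at x" if "x \<in> X" for i x
    unfolding T_def[abs_def]
    using S_diff[OF that, of i] S_nz[OF that, of i] Deriv.has_derivative_inverse
    unfolding differentiable_def by blast
  \<comment> \<open>A derivative of the reciprocal is \<open>- T i * T i\<close> times that of
    \<open>S i\<close>, so no new reciprocal is created.\<close>
  have T_partial: "partial_deriv j (T i) \<in> fun_algebra X H"
    if "base i \<subseteq> fun_algebra X H" "\<And>g. g \<in> base i \<Longrightarrow> partial_deriv j g \<in> fun_algebra X H"
      "T i \<in> fun_algebra X H" for i j H
  proof (rule fun_algebra.cong)
    show "(\<lambda>x. - (T i x * T i x * partial_deriv j (S i) x)) \<in> fun_algebra X H"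
      using S_partial[OF that(1,2)] that(3)
      by (intro fun_algebra_uminus fun_algebra.mult) auto
    show "- (T i x * T i x * partial_deriv j (S i) x) = partial_deriv j (T i) x" if "x \<in> X" for x
      using partial_deriv_inverse[OF S_diff[OF that] S_nz[OF that]] by (simp add: T_def[abs_def])
  qed

  \<comment> \<open>\<open>A i v\<close> contains what can occur after applying the derivatives in \<open>v\<close> to a polynomial in the
    \<open>i\<close>-th jet and \<open>T i\<close>.\<close>
  define A where "A i v = C \<union> {T i} \<union>
    {iter_partial u f |u. mset u \<subseteq># mset v + replicate_mset (\<rho> i) i}" for i v
  have base_A: "base i \<subseteq> A i v" for i v
  proof -
    have "mset (replicate k i) \<subseteq># mset v + replicate_mset (\<rho> i) i" if "k \<le> \<rho> i" for k
      using that by (auto simp: subseteq_mset_def)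
    then show ?thesis unfolding base_def A_def by blast
  qed
  have A_diff: "g differentiable at x" if "g \<in> A i v" "x \<in> X" for g i v x
    using that C_diff diff T_diff by (auto simp: A_def)
  have A_mono: "A i v \<subseteq> A i (j # v)" for i j v
  proof -
    have "mset u \<subseteq># mset (j # v) + replicate_mset (\<rho> i) i"
      if "mset u \<subseteq># mset v + replicate_mset (\<rho> i) i" for u
      by (rule subset_mset.order_trans[OF that]) simp
    then show ?thesis unfolding A_def by blast
  qed
  have A_word: "iter_partial (j # u) f \<in> A i (j # v)"
    if "mset u \<subseteq># mset v + replicate_mset (\<rho> i) i" for i j u v
  proof -
    have "mset (j # u) \<subseteq># mset (j # v) + replicate_mset (\<rho> i) i" using that by simp
    then show ?thesis unfolding A_def by blast
  qed
  have A_partial_base: "partial_deriv j g \<in> fun_algebra X (A i (j # v))" if g: "g \<in> base i" for g i j v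
  proof (cases "g \<in> C")
    case False
    then obtain k where "k \<le> \<rho> i" "g = iter_partial (replicate k i) f"
      using g by (auto simp: base_def)
    then show ?thesis
      using A_word[of "replicate k i" v i j] by (auto simp: subseteq_mset_def intro!: fun_algebra.generator)
  qed (rule C_partial)
  \<comment> \<open>Words gain the one letter \<open>j\<close> that the enlarged bound allows, while
    derivatives of \<open>T i\<close> involve only \<open>T i\<close>, \<open>base i\<close> and
    first derivatives of \<open>base i\<close>.\<close>
  have A_partial: "partial_deriv j g \<in> fun_algebra X (A i (j # v))" if g: "g \<in> fun_algebra X (A i v)" for g i j v
  proof -
    have "partial_deriv j h \<in> fun_algebra X (A i (j # v))" if h: "h \<in> A i v" for h
    proof -
      consider "h \<in> C" | "h = T i" | u where "h = iter_partial u f" "mset u \<subseteq># mset v + replicate_mset (\<rho> i) i"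
        using h by (auto simp: A_def)
      then show ?thesis
      proof cases
        case 1
        then show ?thesis by (rule C_partial)
      next
        case 2
        have "T i \<in> A i (j # v)" by (simp add: A_def)
        then show ?thesis
          unfolding 2 using base_A A_partial_base by (intro T_partial) (auto intro: fun_algebra.generator)
      next
        case 3
        then show ?thesis using A_word[of u v i j] by (auto intro: fun_algebra.generator)
      qed
    qed
    moreover have "A i v \<subseteq> fun_algebra X (A i (j # v))"
      using A_mono fun_algebra.generator by blast
    ultimately show ?thesis
      by (intro fun_algebra_partial_deriv[OF X g A_diff, THEN conjunct2])
  qed

  have top: "\<exists>q\<in>fun_algebra X (base i). \<forall>x\<in>X. iter_partial (replicate (Suc (\<rho> i)) i) f x = T i x * q x" for i
  proof -
    let ?P = "\<lambda>v x. mpoly_eval (mpoly_pderiv v (p i)) (jet f i x)"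
    \<comment> \<open>Differentiating the \<open>i\<close>-th equation in direction \<open>i\<close>
      produces order \<open>\<rho> i + 1\<close> only in the term of \<open>Inr (\<rho> i)\<close>,
      whose coefficient is the separant. All other terms, with the sign changed, make up
      \<open>q\<close>.\<close>
    define q where "q x = - (\<Sum>v\<in>V i - {Inr (\<rho> i)}. ?P v x * partial_deriv i (\<lambda>x. jet f i x v) x)" for x
    have "partial_deriv i (\<lambda>x. jet f i x v) \<in> fun_algebra X (base i)" if v: "v \<in> V i - {Inr (\<rho> i)}" for v
    proof (cases v)
      case (Inl j)
      then show ?thesis unfolding Inl jet_Inl by (intro C_partial) (simp add: C_def)
    next
      case (Inr k)
      then have k: "Suc k \<le> \<rho> i" using v by (auto simp: V_def)
      have "partial_deriv i (\<lambda>x. jet f i x v) = iter_partial (replicate (Suc k) i) f"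
        unfolding Inr jet_Inr by simp
      also have "\<dots> \<in> base i" unfolding base_def using k by blast
      finally show ?thesis by (rule fun_algebra.generator)
    qed
    then have "q \<in> fun_algebra X (base i)"
      unfolding q_def[abs_def]
      by (intro fun_algebra_uminus fun_algebra_sum fun_algebra.mult pderiv_base) auto
    moreover have "iter_partial (replicate (Suc (\<rho> i)) i) f x = T i x * q x" if x: "x \<in> X" for x
    proof -
      have "0 = partial_deriv i (\<lambda>x. mpoly_eval (p i) (jet f i x)) x"
        using partial_deriv_cong[OF X x, of "\<lambda>x. mpoly_eval (p i) (jet f i x)" "\<lambda>_. 0" i] eq[of i]
        by (simp add: DA_equation_def partial_deriv_const)
      also have "\<dots> = (\<Sum>v\<in>V i. ?P v x * partial_deriv i (\<lambda>x. jet f i x v) x)"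
        by (rule partial_deriv_mpoly_eval[OF V]) (use jet_base base_diff x in blast)
      also have "\<dots> = S i x * iter_partial (replicate (Suc (\<rho> i)) i) f x - q x"
      proof -
        have "Inr (\<rho> i) \<in> V i" by (simp add: V_def)
        moreover have "partial_deriv i (\<lambda>x. jet f i x (Inr (\<rho> i))) = iter_partial (replicate (Suc (\<rho> i)) i) f"
          unfolding jet_Inr by simp
        ultimately show ?thesis
          by (subst sum.remove[OF V(1)]) (auto simp: q_def S_def)
      qed
      finally show ?thesis using S_nz[OF x, of i] by (simp add: T_def field_simps)
    qed
    ultimately show ?thesis by blast
  qed
  have over: "iter_partial (v @ replicate (Suc (\<rho> i)) i) f \<in> fun_algebra X (A i v)" for v i
  proof -
    obtain q where q: "q \<in> fun_algebra X (base i)"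
      "\<forall>x\<in>X. iter_partial (replicate (Suc (\<rho> i)) i) f x = T i x * q x"
      using top by blast
    \<comment> \<open>The product agrees with the high-order derivative on \<open>X\<close> only. It
      is differentiated along \<open>v\<close> first, each letter enlarging the generators through
      \<open>A_partial\<close>, and the equality is transported afterwards.\<close>
    have "iter_partial v (\<lambda>x. T i x * q x) \<in> fun_algebra X (A i v)"
    proof (induction v)
      case Nil
      have "T i \<in> A i []" by (simp add: A_def)
      then show ?case
        using fun_algebra_mono[OF q(1) base_A] by (auto intro: fun_algebra.intros)
    qed (simp add: A_partial)
    then show ?thesis
    proof (rule fun_algebra.cong)
      fix x assume x: "x \<in> X"
      show "iter_partial v (\<lambda>x. T i x * q x) x = iter_partial (v @ replicate (Suc (\<rho> i)) i) f x"
        unfolding iter_partial_simps(3)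
        by (rule iter_partial_cong[OF X _ x]) (rule q(2)[rule_format, symmetric])
    qed
  qed

  \<comment> \<open>The box of admissible orders; its words have length at most the sum of all
    \<open>\<rho> i\<close>, which makes it finite.\<close>
  define W where "W = {w :: 'n list. \<forall>i. count (mset w) i \<le> \<rho> i}"
  define G where "G = C \<union> range T \<union> (\<lambda>w. iter_partial w f) ` W"
  have fin: "finite G"
  proof -
    have "length w \<le> (\<Sum>i\<in>UNIV. \<rho> i)" if "w \<in> W" for w
    proof -
      have "length w = (\<Sum>i\<in>set w. count (mset w) i)"
        by (simp add: size_multiset_overloaded_eq flip: size_mset)
      also have "\<dots> \<le> (\<Sum>i\<in>set w. \<rho> i)" using that by (intro sum_mono) (simp add: W_def)
      also have "\<dots> \<le> (\<Sum>i\<in>UNIV. \<rho> i)" by (rule sum_mono2) auto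
      finally show ?thesis .
    qed
    then have "W \<subseteq> {w. set w \<subseteq> UNIV \<and> length w \<le> (\<Sum>i\<in>UNIV. \<rho> i)}" by auto
    then have "finite W" by (rule finite_subset) (rule finite_lists_length_le, simp)
    then show ?thesis by (simp add: G_def C_def)
  qed
  have base_G: "base i \<subseteq> G" for i
    unfolding base_def G_def by (auto simp: W_def)
  have word_partial: "partial_deriv i (iter_partial w f) \<in> fun_algebra X G" if w: "w \<in> W" for i w
  proof (cases "count (mset w) i < \<rho> i")
    case True
    then have "i # w \<in> W" using w by (auto simp: W_def)
    then have "iter_partial (i # w) f \<in> G" unfolding G_def by blast
    then show ?thesis by (simp add: fun_algebra.generator)
  next
    case False
    \<comment> \<open>All \<open>\<rho> i\<close> letters \<open>i\<close> are removed from
      \<open>w\<close>. Hence the bound in \<open>A i v\<close> is exactly the multiset of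
      \<open>w\<close>, and every word below it lies in \<open>W\<close>.\<close>
    define v where "v = filter (\<lambda>j. j \<noteq> i) w"
    have cnt: "count (mset w) i = \<rho> i"
      using w False by (simp add: W_def le_antisym linorder_not_less)
    have mset: "mset v + replicate_mset (\<rho> i) i = mset w"
      by (rule multiset_eqI) (auto simp: v_def cnt)
    have "u \<in> W" if "mset u \<subseteq># mset w" for u
      using w mset_subset_eq_count[OF that] unfolding W_def by (blast intro: order_trans)
    then have "A i v \<subseteq> G" unfolding A_def G_def mset by blast
    with over[of v i] have "iter_partial (v @ replicate (Suc (\<rho> i)) i) f \<in> fun_algebra X G"
      by (rule fun_algebra_mono)
    \<comment> \<open>The extra \<open>i\<close> joins the \<open>\<rho> i\<close> letters taken
      from \<open>w\<close>, and the whole block is moved innermost, where \<open>over\<close>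
      applies.\<close>
    moreover have "mset (v @ replicate (Suc (\<rho> i)) i) = mset (i # w)"
      using mset by simp
    ultimately have "iter_partial (i # w) f \<in> fun_algebra X G"
      using iter_partial_mset_eq[OF an X] by (blast intro: fun_algebra.cong)
    then show ?thesis by simp
  qed
  have base_partial: "partial_deriv j g \<in> fun_algebra X G" if g: "g \<in> base i" for i j g
  proof (cases "g \<in> C")
    case False
    then obtain k where k: "k \<le> \<rho> i" "g = iter_partial (replicate k i) f"
      using g by (auto simp: base_def)
    then have "replicate k i \<in> W" by (simp add: W_def)
    then show ?thesis using word_partial k(2) by blast
  qed (rule C_partial)
  have "closed_generators X G"
    unfolding closed_generators_def
  proof (intro conjI ballI allI fin)
    fix g assume g: "g \<in> G"
    then show "g differentiable at x" if "x \<in> X" for x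
      using that C_diff T_diff diff by (auto simp: G_def)
    from g consider "g \<in> C" | i where "g = T i" | w where "w \<in> W" "g = iter_partial w f"
      by (auto simp: G_def)
    then show "partial_deriv j g \<in> fun_algebra X G" for j
    proof cases
      case (2 i)
      then show ?thesis
        using base_G[of i] base_partial g by (auto intro!: T_partial intro: fun_algebra.generator)
    qed (auto intro: C_partial word_partial)
  qed
  moreover have "f \<in> G"
  proof -
    have "[] \<in> W" by (simp add: W_def)
    then show ?thesis unfolding G_def by force
  qed
  ultimately show ?thesis using that by blast
qed

section \<open>Quadratization\<close>

text \<open>The number of factors is exactly \<open>d\<close>; once the constant 1 belongs to
  \<open>G\<close>, padding with it turns this into at most \<open>d\<close>, see
  \<open>products_mono\<close>.\<close>

definition products :: "('a \<Rightarrow> real) set \<Rightarrow> nat \<Rightarrow> ('a \<Rightarrow> real) set" where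
  "products G d = {\<lambda>x. \<Prod>g\<leftarrow>gs. g x | gs. set gs \<subseteq> G \<and> length gs = d}"

lemma finite_products: "finite G \<Longrightarrow> finite (products G d)"
proof -
  assume "finite G"
  have "products G d = (\<lambda>gs x. \<Prod>g\<leftarrow>gs. g x) ` {gs. set gs \<subseteq> G \<and> length gs = d}"
    by (auto simp: products_def)
  then show ?thesis using finite_lists_length_eq[OF \<open>finite G\<close>] by simp
qed

lemma products_mult:
  assumes "f \<in> products G m" "g \<in> products G n"
  shows "(\<lambda>x. f x * g x) \<in> products G (m + n)"
proof -
  obtain fs gs where "f = (\<lambda>x. \<Prod>g\<leftarrow>fs. g x)" "set fs \<subseteq> G" "length fs = m"
    "g = (\<lambda>x. \<Prod>g\<leftarrow>gs. g x)" "set gs \<subseteq> G" "length gs = n"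
    using assms by (auto simp: products_def)
  then show ?thesis
    unfolding products_def by (intro CollectI exI[of _ "fs @ gs"]) auto
qed

lemma products_1: "g \<in> G \<Longrightarrow> g \<in> products G 1"
  unfolding products_def by (intro CollectI exI[of _ "[g]"]) auto

lemma products_mono:
  assumes "(\<lambda>_. 1) \<in> G" "m \<le> n"
  shows "products G m \<subseteq> products G n"
proof
  fix f assume f: "f \<in> products G m"
  have "(\<lambda>_. 1) \<in> products G (n - m)"
    unfolding products_def using assms(1)
    by (intro CollectI exI[of _ "replicate (n - m) (\<lambda>_. 1)"]) (auto simp: prod_list_replicate)
  from products_mult[OF f this] show "f \<in> products G n" using assms(2) by simp
qed

section \<open>Linear and quadratic combinations of finitely many functions\<close>

definition lin_comb :: "'a set \<Rightarrow> ('a \<Rightarrow> real) set \<Rightarrow> ('a \<Rightarrow> real) \<Rightarrow> bool" where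
  "lin_comb X B f \<longleftrightarrow> (\<exists>a. \<forall>x\<in>X. f x = (\<Sum>b\<in>B. a b * b x))"

definition quad_comb :: "'a set \<Rightarrow> ('a \<Rightarrow> real) set \<Rightarrow> ('a \<Rightarrow> real) \<Rightarrow> bool" where
  "quad_comb X B f \<longleftrightarrow> (\<exists>a. \<forall>x\<in>X. f x = (\<Sum>b\<in>B. \<Sum>c\<in>B. a b c * b x * c x))"

lemma lin_comb_0: "lin_comb X B (\<lambda>_. 0)"
  unfolding lin_comb_def by (intro exI[of _ "\<lambda>_. 0"]) simp

lemma lin_comb_add:
  assumes "lin_comb X B f" "lin_comb X B g"
  shows "lin_comb X B (\<lambda>x. f x + g x)"
proof -
  obtain a a' where "\<forall>x\<in>X. f x = (\<Sum>b\<in>B. a b * b x)" "\<forall>x\<in>X. g x = (\<Sum>b\<in>B. a' b * b x)"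
    using assms by (auto simp: lin_comb_def)
  then show ?thesis
    unfolding lin_comb_def by (intro exI[of _ "\<lambda>b. a b + a' b"]) (simp add: distrib_right sum.distrib)
qed

lemma lin_comb_scale:
  assumes "lin_comb X B f"
  shows "lin_comb X B (\<lambda>x. c * f x)"
proof -
  obtain a where "\<forall>x\<in>X. f x = (\<Sum>b\<in>B. a b * b x)"
    using assms by (auto simp: lin_comb_def)
  then show ?thesis
    unfolding lin_comb_def by (intro exI[of _ "\<lambda>b. c * a b"]) (simp add: sum_distrib_left mult.assoc)
qed

lemma lin_comb_sum:
  "(\<And>k. k \<in> K \<Longrightarrow> lin_comb X B (f k)) \<Longrightarrow> lin_comb X B (\<lambda>x. \<Sum>k\<in>K. f k x)"
  by (induction K rule: infinite_finite_induct) (auto intro: lin_comb_0 lin_comb_add)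

lemma lin_comb_base:
  assumes "finite B" "f \<in> B"
  shows "lin_comb X B f"
  unfolding lin_comb_def
  by (intro exI[of _ "\<lambda>b. if b = f then 1 else 0"])
    (use assms in \<open>simp add: if_distrib[of "\<lambda>a. a * _"] sum.delta cong: if_cong\<close>)

lemma lin_comb_cong: "lin_comb X B f \<Longrightarrow> (\<And>x. x \<in> X \<Longrightarrow> f x = g x) \<Longrightarrow> lin_comb X B g"
  by (simp add: lin_comb_def)

lemma lin_comb_mono:
  assumes "lin_comb X B f" "finite C" "B \<subseteq> C"
  shows "lin_comb X C f"
proof -
  obtain a where a: "\<forall>x\<in>X. f x = (\<Sum>b\<in>B. a b * b x)"
    using assms(1) by (auto simp: lin_comb_def)
  have "lin_comb X C (\<lambda>x. \<Sum>b\<in>B. a b * b x)"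
    by (intro lin_comb_sum lin_comb_scale lin_comb_base) (use assms in auto)
  then show ?thesis by (rule lin_comb_cong) (simp add: a)
qed

lemma quad_comb_0: "quad_comb X B (\<lambda>_. 0)"
  unfolding quad_comb_def by (intro exI[of _ "\<lambda>_ _. 0"]) simp

lemma quad_comb_add:
  assumes "quad_comb X B f" "quad_comb X B g"
  shows "quad_comb X B (\<lambda>x. f x + g x)"
proof -
  obtain a a' where "\<forall>x\<in>X. f x = (\<Sum>b\<in>B. \<Sum>c\<in>B. a b c * b x * c x)"
      "\<forall>x\<in>X. g x = (\<Sum>b\<in>B. \<Sum>c\<in>B. a' b c * b x * c x)"
    using assms by (auto simp: quad_comb_def)
  then show ?thesis
    unfolding quad_comb_def
    by (intro exI[of _ "\<lambda>b c. a b c + a' b c"]) (simp add: distrib_right sum.distrib)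
qed

lemma quad_comb_cong: "quad_comb X B f \<Longrightarrow> (\<And>x. x \<in> X \<Longrightarrow> f x = g x) \<Longrightarrow> quad_comb X B g"
  by (simp add: quad_comb_def)

lemma quad_comb_mult:
  assumes "lin_comb X B f" "lin_comb X B g"
  shows "quad_comb X B (\<lambda>x. f x * g x)"
proof -
  obtain a a' where "\<forall>x\<in>X. f x = (\<Sum>b\<in>B. a b * b x)" "\<forall>x\<in>X. g x = (\<Sum>b\<in>B. a' b * b x)"
    using assms by (auto simp: lin_comb_def)
  then show ?thesis
    unfolding quad_comb_def
    by (intro exI[of _ "\<lambda>b c. a b * a' c"]) (simp add: sum_product, simp add: mult_ac)
qed

lemma lin_comb_products_mult:
  assumes "finite G" "lin_comb X (products G m) f" "lin_comb X (products G n) g"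
  shows "lin_comb X (products G (m + n)) (\<lambda>x. f x * g x)"
proof -
  obtain a a' where a: "\<forall>x\<in>X. f x = (\<Sum>b\<in>products G m. a b * b x)"
      "\<forall>x\<in>X. g x = (\<Sum>b\<in>products G n. a' b * b x)"
    using assms by (auto simp: lin_comb_def)
  have "lin_comb X (products G (m + n))
      (\<lambda>x. \<Sum>b\<in>products G m. \<Sum>c\<in>products G n. (a b * a' c) * (b x * c x))"
    by (intro lin_comb_sum lin_comb_scale lin_comb_base finite_products products_mult assms(1))
  then show ?thesis
    by (rule lin_comb_cong) (simp add: a sum_product, simp add: mult_ac)
qed

text \<open>Filtration of the algebra by degree: sums are padded to the larger degree, products add
  degrees.\<close>

lemma fun_algebra_lin_comb_products:
  assumes G: "finite G" "(\<lambda>_. 1) \<in> G"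
  shows "f \<in> fun_algebra X G \<Longrightarrow> \<exists>d. lin_comb X (products G d) f"
proof (induction rule: fun_algebra.induct)
  case (generator g)
  then show ?case using lin_comb_base[OF finite_products[OF G(1)] products_1] by blast
next
  case (const c)
  have "lin_comb X (products G 1) (\<lambda>x. c * 1)"
    by (rule lin_comb_scale, rule lin_comb_base) (use G finite_products products_1 in auto)
  then show ?case by auto
next
  case (add f g)
  then obtain m n where "lin_comb X (products G m) f" "lin_comb X (products G n) g" by blast
  then have "lin_comb X (products G (max m n)) f" "lin_comb X (products G (max m n)) g"
    using lin_comb_mono[OF _ finite_products[OF G(1)] products_mono[OF G(2)]] by auto
  then show ?case using lin_comb_add by blast
next
  case (mult f g)
  then show ?case using lin_comb_products_mult[OF G(1)] by blast
next
  case (cong f g)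
  then show ?case using lin_comb_cong by blast
qed

text \<open>A single degree serves finitely many functions. The bound \<open>d\<ge>1\<close> later
  places the generators themselves among the products.\<close>

lemma finite_fun_algebra_lin_comb_products:
  assumes G: "finite G" "(\<lambda>_. 1) \<in> G"
  shows "finite H \<Longrightarrow> H \<subseteq> fun_algebra X G \<Longrightarrow> \<exists>d\<ge>1. \<forall>f\<in>H. lin_comb X (products G d) f"
proof (induction H rule: finite_induct)
  case (insert f H)
  then obtain d where d: "d \<ge> 1" "\<forall>f\<in>H. lin_comb X (products G d) f" by auto
  obtain m where m: "lin_comb X (products G m) f"
    using fun_algebra_lin_comb_products[OF G] insert.prems by blast
  have "lin_comb X (products G (max d m)) g" if "g \<in> insert f H" for g
    using that d(2) m lin_comb_mono[OF _ finite_products[OF G(1)] products_mono[OF G(2)]]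
    by (metis insertE max.cobounded1 max.cobounded2)
  then show ?case using d(1) by (intro exI[of _ "max d m"]) auto
qed auto

definition quadratic_generators :: "(real^'n) set \<Rightarrow> (real^'n \<Rightarrow> real) set \<Rightarrow> bool" where
  "quadratic_generators X B \<longleftrightarrow> finite B \<and> (\<forall>b\<in>B. (\<forall>x\<in>X. b differentiable at x) \<and>
     (\<forall>i. quad_comb X B (partial_deriv i b)))"

lemma prod_list_differentiable:
  fixes gs :: "('a::real_normed_vector \<Rightarrow> real) list"
  shows "(\<And>g. g \<in> set gs \<Longrightarrow> g differentiable at x) \<Longrightarrow> (\<lambda>x. \<Prod>g\<leftarrow>gs. g x) differentiable at x"
  by (induction gs) auto

text \<open>In the derivative of a product of \<open>d\<close> factors, each Leibniz term is a
  product of the other factors, again in \<open>B\<close> after padding, times the derivative of one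
  factor, which is linear in \<open>B\<close>.\<close>

lemma closed_generators_quadratic:
  assumes "closed_generators X G"
  obtains B where "quadratic_generators X B" "G \<subseteq> B"
proof -
  define H where "H = insert (\<lambda>_. 1) G"
  have fin: "finite H" and one: "(\<lambda>_. 1) \<in> H"
    using assms by (auto simp: H_def closed_generators_def)
  have diff: "g differentiable at x" if "g \<in> H" "x \<in> X" for g x
    using assms that by (auto simp: H_def closed_generators_def)
  have H_partial: "partial_deriv i g \<in> fun_algebra X H" if "g \<in> H" for i g
  proof (cases "g \<in> G")
    case True
    then have "partial_deriv i g \<in> fun_algebra X G" using assms by (simp add: closed_generators_def)
    then show ?thesis by (rule fun_algebra_mono) (auto simp: H_def)
  next
    case False
    then have "partial_deriv i g = (\<lambda>_. 0)"
      using that by (auto simp: H_def partial_deriv_const)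
    then show ?thesis by (simp add: fun_algebra.const)
  qed
  have "finite ((\<lambda>(i, g). partial_deriv i g) ` (UNIV \<times> H))" using fin by simp
  moreover have "(\<lambda>(i, g). partial_deriv i g) ` (UNIV \<times> H) \<subseteq> fun_algebra X H"
    using H_partial by auto
  ultimately obtain d where d1: "d \<ge> 1"
      "\<forall>f\<in>(\<lambda>(i, g). partial_deriv i g) ` (UNIV \<times> H). lin_comb X (products H d) f"
    using finite_fun_algebra_lin_comb_products[OF fin one] by blast
  then have d: "d \<ge> 1" "\<And>i g. g \<in> H \<Longrightarrow> lin_comb X (products H d) (partial_deriv i g)"
    by auto
  define B where "B = products H d"
  have B_fin: "finite B" using finite_products[OF fin] by (simp add: B_def)
  have products_B: "products H k \<subseteq> B" if "k \<le> d" for k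
    using products_mono[OF one that] by (simp add: B_def)
  \<comment> \<open>The cofactor \<open>c\<close> collects the factors already passed over by the Leibniz rule; one factor is
    being differentiated, so \<open>d + 1\<close> factors are allowed in total.\<close>
  have key: "quad_comb X B (\<lambda>x. c x * partial_deriv i (\<lambda>x. \<Prod>g\<leftarrow>gs. g x) x)"
    if "set gs \<subseteq> H" "c \<in> products H k" "length gs + k \<le> Suc d" for gs c k i
    using that
  proof (induction gs arbitrary: c k)
    case Nil
    then show ?case by (simp add: partial_deriv_const quad_comb_0)
  next
    case (Cons g gs)
    let ?b = "\<lambda>x. \<Prod>g\<leftarrow>gs. g x"
    have g: "g \<in> H" and gs: "set gs \<subseteq> H" using Cons.prems by auto
    have "(\<lambda>x. c x * g x) \<in> products H (k + 1)"
      using products_mult[OF Cons.prems(2) products_1[OF g]] .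
    then have 1: "quad_comb X B (\<lambda>x. c x * g x * partial_deriv i ?b x)"
      using Cons.IH[OF gs] Cons.prems(3) by auto
    \<comment> \<open>With \<open>g\<close> taken out for differentiation,
      \<open>k + length gs\<close> is at most \<open>d\<close>, so the cofactor is a member of
      \<open>B\<close>.\<close>
    have "?b \<in> products H (length gs)" using gs by (auto simp: products_def)
    from products_mult[OF Cons.prems(2) this] have "(\<lambda>x. c x * ?b x) \<in> B"
      using products_B[of "k + length gs"] Cons.prems(3) by auto
    then have 2: "quad_comb X B (\<lambda>x. c x * ?b x * partial_deriv i g x)"
      using lin_comb_base[OF B_fin] d(2)[OF g] by (intro quad_comb_mult) (auto simp: B_def)
    show ?case
    proof (rule quad_comb_cong[OF quad_comb_add[OF 1 2]])
      fix x assume x: "x \<in> X"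
      have "g differentiable at x" "?b differentiable at x"
        using diff[OF _ x] g gs by (auto intro!: prod_list_differentiable)
      from partial_deriv_mult[OF this, of i]
      show "c x * g x * partial_deriv i ?b x + c x * ?b x * partial_deriv i g x
          = c x * partial_deriv i (\<lambda>x. \<Prod>g\<leftarrow>g # gs. g x) x"
        by (simp add: algebra_simps)
    qed
  qed
  show ?thesis
  proof (rule that)
    show "quadratic_generators X B"
      unfolding quadratic_generators_def
    proof (intro conjI ballI allI B_fin)
      fix b assume "b \<in> B"
      then obtain gs where gs: "b = (\<lambda>x. \<Prod>g\<leftarrow>gs. g x)" "set gs \<subseteq> H" "length gs = d"
        by (auto simp: B_def products_def)
      then show "b differentiable at x" if "x \<in> X" for x
        using diff[OF _ that] by (auto intro!: prod_list_differentiable)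
      \<comment> \<open>The initial cofactor 1 counts as one factor; together with the
        \<open>d\<close> factors of \<open>gs\<close> it exhausts the bound
        \<open>Suc d\<close>.\<close>
      have "(\<lambda>_. 1) \<in> products H 1" by (rule products_1[OF one])
      from key[OF gs(2) this, of i for i] show "quad_comb X B (partial_deriv i b)" for i
        using gs by simp
    qed
    show "G \<subseteq> B"
      using products_1[of _ H] products_B[OF d(1)] by (auto simp: H_def)
  qed
qed

section \<open>Quadratic systems\<close>

text \<open>A Gronwall argument: the squared length \<open>E\<close> satisfies
  \<open>E' t \<le> K * E t\<close>, so \<open>E t * exp (- K * t)\<close> is nonincreasing, and it
  starts at zero.\<close>

lemma linear_ode_zero:
  fixes d :: "real \<Rightarrow> nat \<Rightarrow> real" and A :: "real \<Rightarrow> nat \<Rightarrow> nat \<Rightarrow> real"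
  assumes d: "\<And>i t. i < N \<Longrightarrow> t \<in> {0..1} \<Longrightarrow>
      ((\<lambda>t. d t i) has_real_derivative (\<Sum>l<N. A t i l * d t l)) (at t within {0..1})"
    and A: "\<And>i l. i < N \<Longrightarrow> l < N \<Longrightarrow> continuous_on {0..1} (\<lambda>t. A t i l)"
    and zero: "\<And>i. i < N \<Longrightarrow> d 0 i = 0"
    and i: "i < N" and t: "t \<in> {0..1}"
  shows "d t i = 0"
proof -
  have "\<exists>L. \<forall>t\<in>{0..1}. \<bar>A t i l\<bar> \<le> L" if "i < N" "l < N" for i l
    using compact_continuous_image[OF A[OF that] compact_Icc, THEN compact_imp_bounded]
    by (auto simp: bounded_iff)
  then obtain L0 where L0: "\<And>i l t. i < N \<Longrightarrow> l < N \<Longrightarrow> t \<in> {0..1} \<Longrightarrow> \<bar>A t i l\<bar> \<le> L0 i l"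
    by metis
  define L where "L = (\<Sum>i<N. \<Sum>l<N. \<bar>L0 i l\<bar>)"
  have L: "\<bar>A t i l\<bar> \<le> L" if "i < N" "l < N" "t \<in> {0..1}" for i l t
  proof -
    have "\<bar>A t i l\<bar> \<le> \<bar>L0 i l\<bar>" using L0[OF that] by simp
    also have "\<dots> \<le> (\<Sum>l<N. \<bar>L0 i l\<bar>)" by (rule member_le_sum) (use that in auto)
    also have "\<dots> \<le> L" unfolding L_def
      by (rule member_le_sum[of i _ "\<lambda>i. \<Sum>l<N. \<bar>L0 i l\<bar>"]) (use that in \<open>auto intro: sum_nonneg\<close>)
    finally show ?thesis .
  qed
  define E where "E t = (\<Sum>i<N. (d t i)\<^sup>2)" for t
  define E' where "E' t = (\<Sum>i<N. 2 * d t i * (\<Sum>l<N. A t i l * d t l))" for t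
  \<comment> \<open>Summing \<open>L * (d t i)\<^sup>2 + L * (d t l)\<^sup>2\<close> over all pairs
    of indices counts every square \<open>2 * N\<close> times.\<close>
  define K where "K = 2 * real N * L"
  have E': "(E has_real_derivative E' t) (at t within {0..1})" if "t \<in> {0..1}" for t
    unfolding E_def[abs_def] E'_def using d[OF _ that]
    by (auto intro!: derivative_eq_intros sum.cong)
  have E'_le: "E' t \<le> K * E t" if t: "t \<in> {0..1}" for t
  proof -
    have "2 * d t i * (A t i l * d t l) \<le> L * (d t i)\<^sup>2 + L * (d t l)\<^sup>2" if "i < N" "l < N" for i l
    proof -
      have "2 * d t i * (A t i l * d t l) \<le> \<bar>A t i l\<bar> * (2 * \<bar>d t i\<bar> * \<bar>d t l\<bar>)"
        using abs_ge_self[of "2 * d t i * (A t i l * d t l)"] by (simp add: abs_mult mult_ac)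
      also have "\<dots> \<le> L * ((d t i)\<^sup>2 + (d t l)\<^sup>2)"
        using sum_squares_bound[of "\<bar>d t i\<bar>" "\<bar>d t l\<bar>"] L[OF that t]
        by (intro mult_mono) auto
      finally show ?thesis by (simp add: distrib_left)
    qed
    then have "E' t \<le> (\<Sum>i<N. \<Sum>l<N. L * (d t i)\<^sup>2 + L * (d t l)\<^sup>2)"
      unfolding E'_def sum_distrib_left by (intro sum_mono) auto
    also have "\<dots> = K * E t"
      by (simp add: E_def K_def sum.distrib sum_distrib_left algebra_simps)
    finally show ?thesis .
  qed
  have U: "((\<lambda>t. E t * exp (- K * t)) has_real_derivative (E' t - K * E t) * exp (- K * t)) (at t within {0..1})"
    if "t \<in> {0..1}" for t
    using E'[OF that] by (auto intro!: derivative_eq_intros simp: algebra_simps)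
  have "E t * exp (- K * t) \<le> E 0 * exp (- K * 0)"
  proof (rule DERIV_nonpos_imp_decreasing_open[where f = "\<lambda>t. E t * exp (- K * t)"])
    show "0 \<le> t" using t by simp
    show "\<exists>y. DERIV (\<lambda>t. E t * exp (- K * t)) s :> y \<and> y \<le> 0" if s: "0 < s" "s < t" for s
    proof (intro exI conjI)
      have "s \<in> {0..1}" using s t by auto
      from U[OF this] show "DERIV (\<lambda>t. E t * exp (- K * t)) s :> (E' s - K * E s) * exp (- K * s)"
        using s t at_within_Icc_at[of 0 s 1] by simp
      show "(E' s - K * E s) * exp (- K * s) \<le> 0"
        using E'_le[OF \<open>s \<in> {0..1}\<close>] by (intro mult_nonpos_nonneg) auto
    qed
    have "continuous_on {0..1} (\<lambda>t. E t * exp (- K * t))"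
      by (rule DERIV_continuous_on[OF U])
    then show "continuous_on {0..t} (\<lambda>t. E t * exp (- K * t))"
      by (rule continuous_on_subset) (use t in auto)
  qed
  then have "E t \<le> 0" using zero by (simp add: E_def mult_le_0_iff)
  then have "E t = 0" unfolding E_def by (intro antisym sum_nonneg) auto
  then show ?thesis using i by (simp add: E_def sum_nonneg_eq_0_iff)
qed

lemma quadratic_trajectory_unique:
  fixes A :: "nat \<Rightarrow> 'n::finite \<Rightarrow> nat \<Rightarrow> nat \<Rightarrow> real"
  assumes F: "\<And>z i j. F z i j = (\<Sum>k<N. \<Sum>l<N. A i j k l * z k * z l)"
    and z: "is_trajectory N Z F z0 \<xi> z" and w: "is_trajectory N Z F z0 \<xi> w"
    and i: "i < N" and t: "t \<in> {0..1}"
  shows "z t i = w t i"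
proof -
  \<comment> \<open>The difference of two quadratic forms splits by \<open>z k * z l - w k * w l = z
    k * (z l - w l) + w l * (z k - w k)\<close>. Swapping \<open>k\<close> and \<open>l\<close> in
    the second part gives this matrix, continuous in \<open>t\<close> because both trajectories
    are.\<close>
  define M where "M t i l = (\<Sum>j\<in>UNIV. (\<Sum>k<N. A i j k l * z t k + A i j l k * w t k) * \<xi> $ j)" for t i l
  have z_deriv: "((\<lambda>t. z t i) has_real_derivative (\<Sum>j\<in>UNIV. F (z \<tau>) i j * \<xi> $ j)) (at \<tau> within {0..1})"
    if "i < N" "\<tau> \<in> {0..1}" for i \<tau>
    using z that by (simp add: is_trajectory_def)
  have w_deriv: "((\<lambda>t. w t i) has_real_derivative (\<Sum>j\<in>UNIV. F (w \<tau>) i j * \<xi> $ j)) (at \<tau> within {0..1})"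
    if "i < N" "\<tau> \<in> {0..1}" for i \<tau>
    using w that by (simp add: is_trajectory_def)
  have "z t i - w t i = 0"
  proof (rule linear_ode_zero[where A = M and d = "\<lambda>t i. z t i - w t i", OF _ _ _ i t])
    fix i \<tau> assume i: "i < N" and \<tau>: "\<tau> \<in> {0..1::real}"
    have F_diff: "F (z \<tau>) i j - F (w \<tau>) i j
        = (\<Sum>l<N. (\<Sum>k<N. A i j k l * z \<tau> k + A i j l k * w \<tau> k) * (z \<tau> l - w \<tau> l))" for j
    proof -
      have "F (z \<tau>) i j - F (w \<tau>) i j
          = (\<Sum>k<N. \<Sum>l<N. A i j k l * z \<tau> k * (z \<tau> l - w \<tau> l))
          + (\<Sum>k<N. \<Sum>l<N. A i j k l * w \<tau> l * (z \<tau> k - w \<tau> k))"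
        by (simp add: F flip: sum_subtractf sum.distrib) (simp add: algebra_simps)
      also have "(\<Sum>k<N. \<Sum>l<N. A i j k l * z \<tau> k * (z \<tau> l - w \<tau> l))
          = (\<Sum>l<N. \<Sum>k<N. A i j k l * z \<tau> k * (z \<tau> l - w \<tau> l))"
        by (rule sum.swap)
      finally show ?thesis
        by (simp add: sum_distrib_right distrib_right flip: sum.distrib)
    qed
    have "(\<Sum>j\<in>UNIV. F (z \<tau>) i j * \<xi> $ j) - (\<Sum>j\<in>UNIV. F (w \<tau>) i j * \<xi> $ j)
        = (\<Sum>j\<in>UNIV. \<xi> $ j * (F (z \<tau>) i j - F (w \<tau>) i j))"
      by (simp add: algebra_simps flip: sum_subtractf)
    also have "\<dots> = (\<Sum>l<N. M \<tau> i l * (z \<tau> l - w \<tau> l))"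
      unfolding F_diff M_def sum_distrib_left sum_distrib_right
      by (subst sum.swap) (simp add: mult_ac)
    finally show "((\<lambda>t. z t i - w t i) has_real_derivative (\<Sum>l<N. M \<tau> i l * (z \<tau> l - w \<tau> l)))
        (at \<tau> within {0..1})"
      using DERIV_diff[OF z_deriv[OF i \<tau>] w_deriv[OF i \<tau>]] by simp
  next
    fix i l assume "i < N" "l < N"
    have "continuous_on {0..1} (\<lambda>t. z t k)" "continuous_on {0..1} (\<lambda>t. w t k)" if "k < N" for k
      using DERIV_continuous_on[OF z_deriv[OF that]] DERIV_continuous_on[OF w_deriv[OF that]] by auto
    then show "continuous_on {0..1} (\<lambda>t. M t i l)"
      unfolding M_def by (auto intro!: continuous_intros)
  next
    show "z 0 i - w 0 i = 0" for i
      using z w by (simp add: is_trajectory_def)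
  qed
  then show ?thesis by simp
qed


section \<open>Polynomial witnesses and comparison of the three kinds of representation\<close>

lemma quadratic_on_quadratic_form:
  "quadratic_on N Z (\<lambda>z. \<Sum>k<N. \<Sum>l<N. a k l * z k * z l)"
proof -
  let ?m = "\<lambda>k l :: nat. Poly_Mapping.single k 1 + Poly_Mapping.single l 1 :: nat \<Rightarrow>\<^sub>0 nat"
  define p where "p = (\<Sum>k<N. \<Sum>l<N. Poly_Mapping.single (?m k l) (a k l))"
  have keys: "Poly_Mapping.keys (?m k l) \<subseteq> {k, l}" for k l
    by (rule order_trans[OF Poly_Mapping.keys_add]) auto
  have "mpoly_vars (Poly_Mapping.single (?m k l) (a k l)) \<subseteq> {..<N}" if "k < N" "l < N" for k l
    using order_trans[OF mpoly_vars_single keys] that by fastforce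
  then have "mpoly_vars p \<subseteq> {..<N}"
    unfolding p_def by (intro order_trans[OF mpoly_vars_sum] UN_least) auto
  moreover have "mpoly_degree_le 2 (Poly_Mapping.single (?m k l) (a k l))" for k l
  proof -
    have "(\<Sum>x\<in>Poly_Mapping.keys (?m k l). Poly_Mapping.lookup (?m k l) x)
        \<le> (\<Sum>x\<in>{k, l}. Poly_Mapping.lookup (?m k l) x)"
      by (rule sum_mono2) (use keys in auto)
    \<comment> \<open>For \<open>k = l\<close> the set collapses to one variable, with exponent
      2.\<close>
    also have "\<dots> \<le> 2"
      by (cases "k = l") (auto simp: lookup_add lookup_single)
    finally show ?thesis by (auto simp: mpoly_degree_le_def)
  qed
  then have "mpoly_degree_le 2 p"
    unfolding p_def by (intro mpoly_degree_le_sum)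
  moreover have "(\<Sum>k<N. \<Sum>l<N. a k l * z k * z l) = mpoly_eval p z" for z
    by (simp add: p_def mpoly_eval_sum mpoly_eval_single monomial_eval_add monomial_eval_single mult.assoc)
  ultimately show ?thesis unfolding quadratic_on_def by blast
qed

lemma affine_on_imp_polynomial_on:
  assumes "affine_on N Z g"
  shows "polynomial_on N Z g"
proof -
  obtain b a where g: "\<forall>z\<in>Z. g z = b + (\<Sum>i<N. a i * z i)"
    using assms by (auto simp: affine_on_def)
  define p where "p = Poly_Mapping.single 0 b + (\<Sum>i<N. Poly_Mapping.single (Poly_Mapping.single i 1 :: nat \<Rightarrow>\<^sub>0 nat) (a i))"
  have "mpoly_vars (Poly_Mapping.single (Poly_Mapping.single i 1 :: nat \<Rightarrow>\<^sub>0 nat) (a i)) \<subseteq> {..<N}" if "i < N" for i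
    using mpoly_vars_single[of "Poly_Mapping.single i 1" "a i"] that by auto
  moreover have "mpoly_vars (Poly_Mapping.single 0 b :: nat mpoly) \<subseteq> {..<N}"
    using mpoly_vars_single[of "0 :: nat \<Rightarrow>\<^sub>0 nat" b] by auto
  ultimately have "mpoly_vars p \<subseteq> {..<N}"
    unfolding p_def
    by (intro order_trans[OF mpoly_vars_add] Un_least order_trans[OF mpoly_vars_sum] UN_least) auto
  moreover have "b + (\<Sum>i<N. a i * z i) = mpoly_eval p z" for z
    by (simp add: p_def mpoly_eval_add mpoly_eval_sum mpoly_eval_single monomial_eval_0 monomial_eval_single)
  ultimately show ?thesis unfolding polynomial_on_def using g by metis
qed

lemma polynomial_on_imp_rational_on:
  assumes "polynomial_on N Z g"
  shows "rational_on N Z g"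
proof -
  obtain p where p: "mpoly_vars p \<subseteq> {..<N}" "\<forall>z\<in>Z. g z = mpoly_eval p z"
    using assms by (auto simp: polynomial_on_def)
  have "mpoly_eval (Poly_Mapping.single 0 1) z = 1" for z :: "nat \<Rightarrow> real"
    unfolding mpoly_eval_single monomial_eval_0 by simp
  moreover have "mpoly_vars (Poly_Mapping.single 0 1 :: nat mpoly) \<subseteq> {..<N}"
    using mpoly_vars_single[of "0 :: nat \<Rightarrow>\<^sub>0 nat" 1] by auto
  ultimately show ?thesis
    unfolding rational_on_def using p
    by (intro exI[of _ p] exI[of _ "Poly_Mapping.single 0 1"]) auto
qed

lemma Q_FISCIDS_imp_P_FISCIDS:
  assumes "Q_FISCIDS X \<phi> N Z F h z0"
  shows "P_FISCIDS X \<phi> N Z F h z0"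
proof -
  have "polynomial_on N Z g" if "quadratic_on N Z g" for g
    using that by (auto simp: quadratic_on_def polynomial_on_def)
  then show ?thesis
    using assms affine_on_imp_polynomial_on by (auto simp: Q_FISCIDS_def P_FISCIDS_def)
qed

lemma P_FISCIDS_imp_R_FISCIDS: "P_FISCIDS X \<phi> N Z F h z0 \<Longrightarrow> R_FISCIDS X \<phi> N Z F h z0"
  using polynomial_on_imp_rational_on by (auto simp: P_FISCIDS_def R_FISCIDS_def)

text \<open>The state lists the values of the members of \<open>B\<close> along the segment from the
  origin to \<open>\<xi>\<close>, so the chain rule supplies the system and the components of the
  map are among the state coordinates at time 1.\<close>

lemma quadratic_generators_Q_FISCIDS:
  fixes X :: "(real^'n) set" and \<phi> :: "real^'n \<Rightarrow> real^'m"
  assumes star: "star_shaped_at X 0" and B: "quadratic_generators X B"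
    and \<phi>: "\<And>k. (\<lambda>x. \<phi> x $ k) \<in> B"
  shows "\<exists>N Z F h z0. Q_FISCIDS X \<phi> N Z F h z0"
proof -
  define N where "N = card B"
  have "finite B" using B by (simp add: quadratic_generators_def)
  from ex_bij_betw_nat_finite[OF this] obtain e where e: "bij_betw e {..<N} B"
    by (auto simp: N_def atLeast0LessThan)
  have eB: "e i \<in> B" if "i < N" for i
    using bij_betwE[OF e] that by auto
  have ex: "\<exists>a. \<forall>x\<in>X. partial_deriv j (e i) x = (\<Sum>k<N. \<Sum>l<N. a k l * e k x * e l x)" if i: "i < N" for i j
  proof -
    obtain a where a: "\<forall>x\<in>X. partial_deriv j (e i) x = (\<Sum>b\<in>B. \<Sum>c\<in>B. a b c * b x * c x)"
      using B eB[OF i] by (fastforce simp: quadratic_generators_def quad_comb_def)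
    have "(\<Sum>b\<in>B. \<Sum>c\<in>B. a b c * b x * c x) = (\<Sum>k<N. \<Sum>l<N. a (e k) (e l) * e k x * e l x)" for x
      by (simp flip: sum.reindex_bij_betw[OF e])
    with a show ?thesis by (intro exI[of _ "\<lambda>k l. a (e k) (e l)"]) simp
  qed
  define A where "A i j = (SOME a. \<forall>x\<in>X. partial_deriv j (e i) x = (\<Sum>k<N. \<Sum>l<N. a k l * e k x * e l x))" for i j
  have A: "partial_deriv j (e i) x = (\<Sum>k<N. \<Sum>l<N. A i j k l * e k x * e l x)" if "i < N" "x \<in> X" for i j x
    using someI_ex[OF ex[OF that(1), of j]] that(2) unfolding A_def by blast
  have "\<exists>i<N. e i = (\<lambda>x. \<phi> x $ k)" for k
    using e \<phi>[of k] by (auto simp: bij_betw_def image_iff)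
  then obtain idx where idx: "\<And>k. idx k < N" "\<And>k. e (idx k) = (\<lambda>x. \<phi> x $ k)"
    by metis

  \<comment> \<open>The vector field is polynomial, so the whole state space can be taken as its
    domain.\<close>
  define Z where "Z = topspace (Euclidean_space N)"
  define F where "F z i j = (\<Sum>k<N. \<Sum>l<N. A i j k l * z k * z l)" for z :: "nat \<Rightarrow> real" and i and j :: 'n
  define h where "h z = (\<chi> k. z (idx k))" for z :: "nat \<Rightarrow> real"
  \<comment> \<open>Coordinates from \<open>N\<close> on are set to zero, as membership in
    \<open>Euclidean_space N\<close> demands.\<close>
  define traj where "traj \<xi> \<tau> i = (if i < N then e i (\<tau> *\<^sub>R \<xi>) else 0)" for \<xi> and \<tau> :: real and i
  \<comment> \<open>The values of \<open>B\<close> at the origin, where the segments to all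
    \<open>\<xi>\<close> begin; hence the initial state is independent of
    \<open>\<xi>\<close>.\<close>
  define z0 where "z0 = traj 0 0"
  have traj: "is_trajectory N Z F z0 \<xi> (traj \<xi>)" if \<xi>: "\<xi> \<in> X" for \<xi>
    unfolding is_trajectory_def
  proof (intro conjI ballI allI impI)
    show "traj \<xi> 0 = z0" by (simp add: z0_def traj_def fun_eq_iff)
    fix \<tau> :: real assume \<tau>: "\<tau> \<in> {0..1}"
    then have X: "\<tau> *\<^sub>R \<xi> \<in> X" using star \<xi> by (fastforce simp: star_shaped_at_def)
    show "traj \<xi> \<tau> \<in> Z" by (simp add: Z_def topspace_Euclidean_space traj_def)
    fix i assume i: "i < N"
    have "e i differentiable at (\<tau> *\<^sub>R \<xi>)"
      using B eB[OF i] X by (simp add: quadratic_generators_def)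
    note 1 = differentiable_has_derivative_partial[OF this]
    have "((\<lambda>t. t *\<^sub>R \<xi>) has_derivative (\<lambda>t. t *\<^sub>R \<xi>)) (at \<tau>)"
      by (auto intro!: derivative_eq_intros)
    from has_derivative_compose[OF this 1]
    have "((\<lambda>t. e i (t *\<^sub>R \<xi>)) has_derivative (\<lambda>t. \<Sum>j\<in>UNIV. (t *\<^sub>R \<xi>) $ j * partial_deriv j (e i) (\<tau> *\<^sub>R \<xi>))) (at \<tau>)" .
    then have "((\<lambda>t. e i (t *\<^sub>R \<xi>)) has_real_derivative (\<Sum>j\<in>UNIV. partial_deriv j (e i) (\<tau> *\<^sub>R \<xi>) * \<xi> $ j)) (at \<tau>)"
      by (rule has_derivative_imp_has_field_derivative) (simp add: sum_distrib_left mult_ac)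
    moreover have "partial_deriv j (e i) (\<tau> *\<^sub>R \<xi>) = F (traj \<xi> \<tau>) i j" for j
      by (simp add: A[OF i X] F_def traj_def)
    ultimately show "((\<lambda>t. traj \<xi> t i) has_real_derivative (\<Sum>j\<in>UNIV. F (traj \<xi> \<tau>) i j * \<xi> $ j)) (at \<tau> within {0..1})"
      using i by (simp add: traj_def has_field_derivative_at_within)
  qed
  have "FISCIDS X \<phi> N Z F h z0"
    unfolding FISCIDS_def
  proof (intro conjI ballI allI impI)
    show "openin (Euclidean_space N) Z" by (simp add: Z_def)
    show "z0 \<in> Z" by (simp add: Z_def topspace_Euclidean_space z0_def traj_def)
    fix \<xi> assume \<xi>: "\<xi> \<in> X"
    show "\<exists>z. is_trajectory N Z F z0 \<xi> z" using traj[OF \<xi>] by blast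
    fix z assume z: "is_trajectory N Z F z0 \<xi> z"
    \<comment> \<open>An arbitrary trajectory agrees with \<open>traj \<xi>\<close> in the first
      \<open>N\<close> coordinates, and the output reads only such coordinates.\<close>
    have "z 1 (idx k) = \<phi> \<xi> $ k" for k
      using quadratic_trajectory_unique[OF F_def z traj[OF \<xi>] idx(1), of 1 k] idx
      by (simp add: traj_def)
    then show "h (z 1) = \<phi> \<xi>" by (simp add: h_def vec_eq_iff)
  qed
  moreover have "quadratic_on N Z (\<lambda>z. F z i j)" for i j
    unfolding F_def by (rule quadratic_on_quadratic_form)
  moreover have "affine_on N Z (\<lambda>z. h z $ k)" for k
    unfolding affine_on_def h_def using idx(1)[of k]
    by (intro exI[of _ 0] exI[of _ "\<lambda>i. if i = idx k then 1 else 0"])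
      (simp add: if_distrib[of "\<lambda>a. a * _"] cong: if_cong)
  ultimately show ?thesis unfolding Q_FISCIDS_def by blast
qed

theorem theorem4:
  fixes X :: "(real^'n) set" and \<phi> :: "real^'n \<Rightarrow> real^'m"
  assumes "open X"
    and "star_shaped_at X 0"
    and "nonsingular_DA_map X \<phi>"
  shows "(\<exists>N Z F h z0. R_FISCIDS X \<phi> N Z F h z0) \<and>
         (\<exists>N Z F h z0. P_FISCIDS X \<phi> N Z F h z0) \<and>
         (\<exists>N Z F h z0. Q_FISCIDS X \<phi> N Z F h z0)"
proof -
  have "\<exists>G. closed_generators X G \<and> (\<lambda>x. \<phi> x $ k) \<in> G" for k
    using assms(1,3) nonsingular_DA_function_closed_generators unfolding nonsingular_DA_map_def by metis
  then obtain G where G: "\<And>k. closed_generators X (G k)" "\<And>k. (\<lambda>x. \<phi> x $ k) \<in> G k"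
    by metis
  have "closed_generators X (\<Union>k\<in>UNIV. G k)"
    by (rule closed_generators_UN) (use G in auto)
  then obtain B where "quadratic_generators X B" "(\<Union>k\<in>UNIV. G k) \<subseteq> B"
    by (rule closed_generators_quadratic)
  then obtain N Z F h z0 where "Q_FISCIDS X \<phi> N Z F h z0"
    using quadratic_generators_Q_FISCIDS[OF assms(2), of B \<phi>] G(2) by blast
  then show ?thesis
    using Q_FISCIDS_imp_P_FISCIDS P_FISCIDS_imp_R_FISCIDS by blast
qed

end
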